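(* For each positive integer $n$ let $\bm{X}_n = (X_{n,1}, \ldots, X_{n,k_n})$ be a random vector in $(0,\infty)^{k_n}$, where $k_n \ge 2$ are integers with $k_n \to \infty$ as $n\to\infty$. Assume that $$\lim_{n \to \infty} \Pr(X_{n,1} = \ldots = X_{n,k_n}) = 0,$$ and that there exist $\alpha_0\in(0,\infty)$ and a positive sequence $(\sigma_n)_{n\in\mathbb{N}}$ such that the following two statements hold: (i) There exist $0<\alpha_-<\alpha_0<\alpha_+<\infty$ such that, for all $f\in\mathcal{F}_2(\alpha_-,\alpha_+)$, $\frac{1}{k_n}\sum_{i=1}^{k_n} f(X_{n,i}/\sigma_n) \rightsquigarrow \int_0^\infty f(x)\, p_{\alpha_0,1}(x)\, \mathrm{d}x$ as $n\to\infty$. (ii) There exist a sequence $0<v_n\to\infty$ and a random vector $\bm{Y}=(Y_1,Y_2,Y_3)^T$ such that, with $$\mathbb{G}_n f = v_n\left(\frac1{k_n}\sum_{i=1}^{k_n} f(X_{n,i}/\sigma_n) - \int_0^\infty f(x)\,p_{\alpha_0,1}(x)\,\mathrm{d}x\right),$$ we have $$(\mathbb{G}_n f_1,\mathbb{G}_n f_2,\mathbb{G}_n f_3)^T\rightsquigarrow\bm{Y}, \qquad n\to\infty,$$ where $f_1(x)=x^{-\alpha_0}\log(x)$, $f_2(x)=x^{-\alpha_0}$, $f_3(x)=\log(x)$ for $x>0$. Then, as $n\to\infty$, the maximum likelihood estimator $(\hat\alpha_n,\hat\sigma_n)$ satisfies $$\begin{pmatrix} v_n(\hat\alpha_n-\alpha_0)\\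 v_n(\hat\sigma_n/\sigma_n-1)\end{pmatrix} = M(\alpha_0)\begin{pmatrix}\mathbb{G}_n f_1\\ \mathbb{G}_n f_2\\ \mathbb{G}_n f_3\end{pmatrix}+o_p(1)\rightsquigarrow M(\alpha_0)\bm{Y}.$$
   Context: The arrow $\rightsquigarrow$ denotes weak convergence (convergence in distribution). For $\alpha_0>0$, $p_{\alpha_0,1}(x)=\alpha_0\exp(-x^{-\alpha_0})x^{-\alpha_0-1}$, $x>0$, is the density of the Fr\'echet distribution with shape $\alpha_0$ and scale $1$. $\mathcal{F}_2(\alpha_-,\alpha_+) = \{x\mapsto \log x\}\cup\{x\mapsto x^{-\alpha}: \alpha_-<\alpha<\alpha_+\}\cup\{x\mapsto x^{-\alpha}\log x: \alpha_-<\alpha<\alpha_+\}\cup\{x\mapsto x^{-\alpha}(\log x)^2:\alpha_-<\alpha<\alpha_+\}$, functions from $(0,\infty)$ to $\mathbb{R}$. Estimators (Fr\'echet maximum likelihood estimators): for $\bm{x}=(x_1,\dots,x_k)\in(0,\infty)^k$ and $\alpha>0$ let $$\Psi_k(\alpha\mid\bm{x}) = \frac1\alpha + \frac{\frac1k\sum_{i=1}^k x_i^{-\alpha}\log(x_i)}{\frac1k\sum_{i=1}^k x_i^{-\alpha}} - \frac1k\sum_{i=1}^k\log(x_i).$$ If $x_1,\ldots,x_k$ are not all equal, $\alpha\mapsto\Psi_k(\alpha\mid\bm{x})$ has a unique zero in $(0,\infty)$. On the event that $X_{n,1},\ldots,X_{n,k_n}$ are not all equal, $\hat\alpha_n$ is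 the unique zero of $\alpha\mapsto\Psi_{k_n}(\alpha\mid\bm{X}_n)$ and $\hat\sigma_n = \bigl(\frac1{k_n}\sum_{i=1}^{k_n}X_{n,i}^{-\hat\alpha_n}\bigr)^{-1/\hat\alpha_n}$; then $(\hat\alpha_n,\hat\sigma_n)$ is the unique maximizer of the Fr\'echet log-likelihood of the sample. On the event $\{X_{n,1}=\ldots=X_{n,k_n}\}$, put $\hat\alpha_n=\infty$ and $\hat\sigma_n=X_{n,1}$. With $\Gamma$ the Euler gamma function, $\gamma=-\Gamma'(1)$ the Euler--Mascheroni constant and $\Gamma''(2)=(1-\gamma)^2+\pi^2/6-1$, $$M(\alpha_0)=\frac{6}{\pi^2}\begin{pmatrix}\alpha_0^2 & \alpha_0(1-\gamma) & -\alpha_0^2\\ \gamma-1 & -(\Gamma''(2)+1)/\alpha_0 & 1-\gamma\end{pmatrix}.$$ *)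

theory Defs
  imports "HOL-Probability.Probability"
begin

section \<open>Convergence in distribution and in probability\<close>

text \<open>
  The random elements \<open>Z n\<close> may live on different probability spaces \<open>M n\<close>; the limit is given by
  its law \<open>\<nu>\<close> on the Borel sets. The library has weak convergence for laws on the real line only
  (\<^const>\<open>weak_conv_m\<close>); the lemma below shows that the two notions agree there.
\<close>

definition conv_in_distr ::
  "(nat \<Rightarrow> 'a measure) \<Rightarrow> (nat \<Rightarrow> 'a \<Rightarrow> 'c::topological_space) \<Rightarrow> 'c measure \<Rightarrow> bool" where
  "conv_in_distr M Z \<nu> \<longleftrightarrow>
     (\<forall>n. Z n \<in> borel_measurable (M n)) \<and>
     (\<forall>f::'c \<Rightarrow> real. continuous_on UNIV f \<and> bounded (range f) \<longrightarrow>
        (\<lambda>n. \<integral>\<omega>. f (Z n \<omega>) \<partial>M n) \<longlonglongrightarrow> (\<integral>z. f z \<partial>\<nu>))"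

lemma conv_in_distr_real_iff:
  fixes Z :: "nat \<Rightarrow> 'a \<Rightarrow> real"
  assumes M: "\<And>n. prob_space (M n)" and Z: "\<And>n. Z n \<in> borel_measurable (M n)"
    and \<nu>: "real_distribution \<nu>"
  shows "conv_in_distr M Z \<nu> \<longleftrightarrow> weak_conv_m (\<lambda>n. distr (M n) borel (Z n)) \<nu>"
proof -
  have rd: "real_distribution (distr (M n) borel (Z n))" for n
    using prob_space.real_distribution_distr[OF M Z] .
  have eq: "(\<integral>x. f x \<partial>distr (M n) borel (Z n)) = (\<integral>\<omega>. f (Z n \<omega>) \<partial>M n)"
    if "continuous_on UNIV f" for f :: "real \<Rightarrow> real" and n
    using Z that by (intro integral_distr) (auto intro: borel_measurable_continuous_onI)
  show ?thesis
  proof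
    assume c: "conv_in_distr M Z \<nu>"
    show "weak_conv_m (\<lambda>n. distr (M n) borel (Z n)) \<nu>"
    proof (rule integral_bdd_continuous_conv_imp_weak_conv[OF rd \<nu>])
      fix f :: "real \<Rightarrow> real"
      assume f: "\<And>x. isCont f x" "\<And>x. \<bar>f x\<bar> \<le> 1"
      have "continuous_on UNIV f" "bounded (range f)"
        using f by (auto simp: continuous_on_eq_continuous_at bounded_iff)
      then show "(\<lambda>n. integral\<^sup>L (distr (M n) borel (Z n)) f) \<longlonglongrightarrow> integral\<^sup>L \<nu> f"
        using c by (simp add: conv_in_distr_def eq)
    qed
  next
    assume w: "weak_conv_m (\<lambda>n. distr (M n) borel (Z n)) \<nu>"
    show "conv_in_distr M Z \<nu>"
      unfolding conv_in_distr_def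
    proof (intro conjI allI impI Z)
      fix f :: "real \<Rightarrow> real"
      assume f: "continuous_on UNIV f \<and> bounded (range f)"
      then obtain B where "\<And>x. norm (f x) \<le> B"
        by (auto simp: bounded_iff)
      moreover have "isCont f x" for x
        using f by (simp add: continuous_on_eq_continuous_at)
      ultimately have "(\<lambda>n. integral\<^sup>L (distr (M n) borel (Z n)) f) \<longlonglongrightarrow> integral\<^sup>L \<nu> f"
        using weak_conv_imp_integral_bdd_continuous_conv[OF rd \<nu> w] by blast
      then show "(\<lambda>n. \<integral>\<omega>. f (Z n \<omega>) \<partial>M n) \<longlonglongrightarrow> integral\<^sup>L \<nu> f"
        using f by (simp add: eq)
    qed
  qed
qed

text \<open>
  \<open>R n = o\<^sub>p(1)\<close> for random vectors with extended real coordinates (see the shape estimator below).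
\<close>

definition small_o_p :: "(nat \<Rightarrow> 'a measure) \<Rightarrow> (nat \<Rightarrow> 'a \<Rightarrow> ereal ^ 'd) \<Rightarrow> bool" where
  "small_o_p M R \<longleftrightarrow>
     (\<forall>n. R n \<in> borel_measurable (M n)) \<and>
     (\<forall>\<epsilon>>0. (\<lambda>n. \<P>(\<omega> in M n. \<exists>i. \<bar>R n \<omega> $ i\<bar> > ereal \<epsilon>)) \<longlonglongrightarrow> 0)"

definition ereal_vec :: "real ^ 'd \<Rightarrow> ereal ^ 'd" where
  "ereal_vec x = (\<chi> i. ereal (x $ i))"


section \<open>The Frechet distribution with scale one\<close>

definition frechet_density :: "real \<Rightarrow> real \<Rightarrow> real" where
  "frechet_density \<alpha> x = \<alpha> * exp (- (x powr - \<alpha>)) * x powr (- \<alpha> - 1)"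

definition frechet_expectation :: "real \<Rightarrow> (real \<Rightarrow> real) \<Rightarrow> real" where
  "frechet_expectation \<alpha> f = (LBINT x:{0<..}. f x * frechet_density \<alpha> x)"

text \<open>Only the values on \<open>(0, \<infinity>)\<close> of the following functions matter.\<close>

definition F2 :: "real \<Rightarrow> real \<Rightarrow> (real \<Rightarrow> real) set" where
  "F2 \<alpha>m \<alpha>p =
     {\<lambda>x. ln x}
     \<union> {\<lambda>x. x powr - \<alpha> |\<alpha>. \<alpha>m < \<alpha> \<and> \<alpha> < \<alpha>p}
     \<union> {\<lambda>x. x powr - \<alpha> * ln x |\<alpha>. \<alpha>m < \<alpha> \<and> \<alpha> < \<alpha>p}
     \<union> {\<lambda>x. x powr - \<alpha> * (ln x)\<^sup>2 |\<alpha>. \<alpha>m < \<alpha> \<and> \<alpha> < \<alpha>p}"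


section \<open>The maximum likelihood estimator\<close>

text \<open>A sample of size \<open>k\<close> is a function \<open>x\<close>, of which only \<open>x 1, \<dots>, x k\<close> are used.\<close>

definition sample_mean :: "nat \<Rightarrow> (nat \<Rightarrow> real) \<Rightarrow> (real \<Rightarrow> real) \<Rightarrow> real" where
  "sample_mean k x f = 1 / real k * (\<Sum>i=1..k. f (x i))"

definition all_equal :: "nat \<Rightarrow> (nat \<Rightarrow> real) \<Rightarrow> bool" where
  "all_equal k x \<longleftrightarrow> (\<forall>i\<in>{1..k}. \<forall>j\<in>{1..k}. x i = x j)"

definition Psi :: "nat \<Rightarrow> (nat \<Rightarrow> real) \<Rightarrow> real \<Rightarrow> real" where
  "Psi k x \<alpha> =
     1 / \<alpha>
     + sample_mean k x (\<lambda>y. y powr - \<alpha> * ln y) / sample_mean k x (\<lambda>y. y powr - \<alpha>)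
     - sample_mean k x ln"

definition mle_shape :: "nat \<Rightarrow> (nat \<Rightarrow> real) \<Rightarrow> ereal" where
  "mle_shape k x =
     (if all_equal k x then \<infinity> else ereal (THE \<alpha>. \<alpha> > 0 \<and> Psi k x \<alpha> = 0))"

definition mle_scale :: "nat \<Rightarrow> (nat \<Rightarrow> real) \<Rightarrow> real" where
  "mle_scale k x =
     (if all_equal k x then x 1
      else let \<alpha> = real_of_ereal (mle_shape k x)
           in sample_mean k x (\<lambda>y. y powr - \<alpha>) powr (- 1 / \<alpha>))"

text \<open>
  The rescaled estimation error with rate \<open>v\<close>, centred at shape \<open>\<alpha>\<^sub>0\<close> and scale \<open>\<sigma>\<close>. Its first
  coordinate is infinite if all observations are equal, whence the type. For a limit law carried by
  the finite vectors, convergence in distribution in \<open>ereal ^ 2\<close> is the usual one in \<open>real ^ 2\<close>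
  up to the event of an infinite coordinate, whose probability then tends to zero.
\<close>

definition mle_error :: "real \<Rightarrow> real \<Rightarrow> real \<Rightarrow> nat \<Rightarrow> (nat \<Rightarrow> real) \<Rightarrow> ereal ^ 2" where
  "mle_error \<alpha>\<^sub>0 v \<sigma> k x =
     vector [ereal v * (mle_shape k x - ereal \<alpha>\<^sub>0), ereal (v * (mle_scale k x / \<sigma> - 1))]"


section \<open>The empirical process and the limit matrix\<close>

definition emp_process ::
  "real \<Rightarrow> real \<Rightarrow> real \<Rightarrow> nat \<Rightarrow> (nat \<Rightarrow> real) \<Rightarrow> (real \<Rightarrow> real) \<Rightarrow> real" where
  "emp_process \<alpha>\<^sub>0 v \<sigma> k x f =
     v * (sample_mean k (\<lambda>i. x i / \<sigma>) f - frechet_expectation \<alpha>\<^sub>0 f)"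

definition emp_vec :: "real \<Rightarrow> real \<Rightarrow> real \<Rightarrow> nat \<Rightarrow> (nat \<Rightarrow> real) \<Rightarrow> real ^ 3" where
  "emp_vec \<alpha>\<^sub>0 v \<sigma> k x =
     vector [emp_process \<alpha>\<^sub>0 v \<sigma> k x (\<lambda>y. y powr - \<alpha>\<^sub>0 * ln y),
             emp_process \<alpha>\<^sub>0 v \<sigma> k x (\<lambda>y. y powr - \<alpha>\<^sub>0),
             emp_process \<alpha>\<^sub>0 v \<sigma> k x ln]"

abbreviation Gamma''2 :: real where
  "Gamma''2 \<equiv> deriv (deriv Gamma) 2"

definition M_mat :: "real \<Rightarrow> real ^ 3 ^ 2" where
  "M_mat \<alpha>\<^sub>0 = (6 / pi\<^sup>2) *\<^sub>R
     vector [vector [\<alpha>\<^sub>0\<^sup>2, \<alpha>\<^sub>0 * (1 - euler_mascheroni), - (\<alpha>\<^sub>0\<^sup>2)],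
             vector [euler_mascheroni - 1, - (Gamma''2 + 1) / \<alpha>\<^sub>0, 1 - euler_mascheroni]]"

lemma deriv_Gamma_1: "deriv Gamma (1::real) = - euler_mascheroni"
proof -
  have "(Gamma has_field_derivative Gamma 1 * Digamma 1) (at (1::real))"
    by (rule has_field_derivative_Gamma) auto
  then show ?thesis
    by (simp add: DERIV_imp_deriv)
qed

lemma Gamma''2_eq: "Gamma''2 = (1 - euler_mascheroni)\<^sup>2 + pi\<^sup>2 / 6 - 1"
proof -
  have pos: "x \<notin> \<int>\<^sub>\<le>\<^sub>0" if "x > 0" for x :: real
    using that by (auto elim!: nonpos_Ints_cases)
  have d1: "deriv Gamma x = Gamma x * Digamma x" if "x > 0" for x :: real
    using has_field_derivative_Gamma[OF pos[OF that], of UNIV] by (simp add: DERIV_imp_deriv)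
  have "((\<lambda>x. Gamma x * Digamma x) has_field_derivative
          (Gamma 2 * Digamma 2) * Digamma 2 + Polygamma (Suc 0) 2 * Gamma 2) (at (2::real))"
    using pos[of 2] by (intro DERIV_mult has_field_derivative_Gamma has_field_derivative_Polygamma) auto
  then have "deriv (\<lambda>x. Gamma x * Digamma x) (2::real)
      = (Gamma 2 * Digamma 2) * Digamma 2 + Polygamma (Suc 0) 2 * Gamma 2"
    by (rule DERIV_imp_deriv)
  moreover have "eventually (\<lambda>x. deriv Gamma x = Gamma x * Digamma x) (nhds (2::real))"
    using eventually_nhds_in_open[of "{0<..}" "2::real"] by (auto elim!: eventually_mono simp: d1)
  then have "Gamma''2 = deriv (\<lambda>x. Gamma x * Digamma x) (2::real)"
    by (rule deriv_cong_ev) simp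
  moreover have "Gamma (2::real) = 1"
    using Gamma_fact[of 1, where 'a = real] by simp
  moreover have "Digamma (2::real) = 1 - euler_mascheroni"
    using Digamma_plus1[of "1::real"] by simp
  moreover have "Polygamma (Suc 0) (2::real) = pi\<^sup>2 / 6 - 1"
  proof -
    have "(\<lambda>n. inverse ((1 + real n) ^ 2)) sums (pi\<^sup>2 / 6)"
      using inverse_squares_sums by (simp add: field_simps)
    then have "Polygamma (Suc 0) (1::real) = pi\<^sup>2 / 6"
      by (simp add: Polygamma_def sums_iff numeral_2_eq_2 inverse_eq_divide)
    then show ?thesis
      using Polygamma_plus1[of "1::real" "Suc 0"] by simp
  qed
  ultimately show ?thesis
    by (simp add: power2_eq_square)
qed

end

theory Submission
  imports Defs
begin

text \<open>
  Dividing the sample by \<open>\<sigma> n\<close> changes neither the likelihood equation nor the relative error of the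
  scale estimator, so only rescaled samples matter. Write \<open>s\<^sub>j(\<alpha>)\<close> for the sample mean of
  \<open>y powr - \<alpha> * (ln y)^j\<close> (this is \<open>power_log_mean j\<close> below), so that
  \<open>Psi(\<alpha>) = 1/\<alpha> + s\<^sub>1(\<alpha>)/s\<^sub>0(\<alpha>) - s\<close> with \<open>s\<close> the mean of the logarithms.

  The usual argument for such an estimator expands the likelihood equation
  \<open>Psi(\<alpha>) = 0\<close> around \<open>\<alpha>\<^sub>0\<close>. Under the Frechet law, \<open>y powr - \<alpha>\<^sub>0\<close> is standard exponential, so the
  limits of \<open>s\<close> and of the \<open>s\<^sub>j(\<alpha>\<^sub>0)\<close> are derivatives of the Gamma function (\<open>frechet_moments\<close>).
  They make the score vanish at \<open>\<alpha>\<^sub>0\<close> and give it the slope \<open>- \<pi>\<^sup>2 / (6 \<alpha>\<^sub>0\<^sup>2)\<close>, from which the first row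
  of \<open>M_mat\<close> results. The second row follows by inserting the expansion of the shape estimator
  into the formula for the scale estimator.

  Two observations replace the uniform laws of large numbers that the expansion seems to require.

  First, \<open>s\<^sub>1/s\<^sub>0\<close> is nonincreasing for every sample, whence \<open>Psi\<close> decreases at least as
  fast as \<open>1/\<alpha>\<close> (\<open>Psi_decrease\<close>). So the root \<open>a\<close> satisfies
  \<open>\<bar>1/a - 1/\<alpha>\<^sub>0\<bar> \<le> \<bar>Psi(\<alpha>\<^sub>0)\<bar>\<close> without any probability (\<open>Psi_zero_close\<close>). As \<open>v n\<close> times the score at
  \<open>\<alpha>\<^sub>0\<close> is tight, the estimator is consistent with rate \<open>v n\<close>.

  Second, with \<open>h = a - \<alpha>\<^sub>0\<close>, the remainders in the linear expansions of \<open>s\<^sub>0\<close> and \<open>s\<^sub>1\<close> at \<open>\<alpha>\<^sub>0\<close> are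
  at most a constant times \<open>h\<^sup>2 (s\<^sub>2(\<alpha>\<^sub>0 + \<delta>) + s\<^sub>2(\<alpha>\<^sub>0 - \<delta>))\<close>, where the bracket is tight by (i).
  After multiplication by \<open>v n\<close> they vanish, since \<open>v h\<^sup>2 = (v h) h\<close>.

  All this is a statement about single samples (\<open>mle_error_approx\<close>): if the empirical process is
  bounded by \<open>B\<close>, a few sample means are close to their limits, and \<open>v n\<close> is large, then the expansion
  holds up to \<open>\<epsilon>\<close>. Tightness and a union bound turn it into \<open>o\<^sub>p(1)\<close>, and the limit law follows from
  the continuous mapping theorem and Slutsky's lemma.
\<close>


section \<open>Moments of the Frechet distribution\<close>

lemma abs_ln_le_powr:
  fixes t \<eta> :: real
  assumes "t > 0" "\<eta> > 0"
  shows "\<bar>ln t\<bar> \<le> (t powr \<eta> + t powr - \<eta>) / \<eta>"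
proof -
  have "y \<le> exp y" for y :: real
    using exp_ge_add_one_self[of y] by linarith
  from this[of "\<eta> * ln t"] this[of "- (\<eta> * ln t)"]
  have "\<eta> * ln t \<le> t powr \<eta>" "- (\<eta> * ln t) \<le> t powr - \<eta>"
    using assms by (simp_all add: powr_def)
  moreover have "0 \<le> t powr \<eta>" "0 \<le> t powr - \<eta>" by simp_all
  ultimately have "\<bar>\<eta> * ln t\<bar> \<le> t powr \<eta> + t powr - \<eta>"
    by linarith
  then have "\<eta> * \<bar>ln t\<bar> \<le> t powr \<eta> + t powr - \<eta>"
    using assms by (simp add: abs_mult)
  then show ?thesis
    using assms by (simp add: field_simps)
qed

lemma exp_remainder: "\<bar>exp y - 1 - y\<bar> \<le> exp \<bar>y\<bar> * y\<^sup>2" for y :: real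
  using Taylor_exp_field[of y 1] by (simp add: numeral_2_eq_2 algebra_simps)

text \<open>
  Taylor expansion in the exponent. The remainder has to be integrable in \<open>t\<close> over all of \<open>(0, \<infinity>)\<close>,
  so its bound uses only powers of \<open>t\<close> and \<open>ln t\<close>. It serves two measures: the exponential
  distribution, to differentiate the Gamma integral, and the empirical distribution of the sample,
  to expand the likelihood equation.
\<close>

lemma powr_remainder:
  fixes t a h \<eta> :: real
  assumes "t > 0" "\<bar>h\<bar> \<le> \<eta>"
  shows "\<bar>t powr (a + h) - t powr a - h * (t powr a * ln t)\<bar>
           \<le> h\<^sup>2 * ((t powr (a + \<eta>) + t powr (a - \<eta>)) * (ln t)\<^sup>2)"
proof -
  have "exp \<bar>h * ln t\<bar> \<le> exp (\<eta> * \<bar>ln t\<bar>)"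
    using assms by (simp add: abs_mult mult_right_mono)
  also have "\<dots> \<le> t powr \<eta> + t powr - \<eta>"
    using assms by (cases "ln t \<ge> 0") (auto simp: powr_def)
  finally have e: "exp \<bar>h * ln t\<bar> \<le> t powr \<eta> + t powr - \<eta>" .
  have "t powr (a + h) - t powr a - h * (t powr a * ln t) = t powr a * (exp (h * ln t) - 1 - h * ln t)"
    using assms by (simp add: powr_add powr_def algebra_simps exp_add)
  then have "\<bar>t powr (a + h) - t powr a - h * (t powr a * ln t)\<bar>
      = t powr a * \<bar>exp (h * ln t) - 1 - h * ln t\<bar>"
    by (simp add: abs_mult)
  also have "\<dots> \<le> t powr a * ((t powr \<eta> + t powr - \<eta>) * (h * ln t)\<^sup>2)"
    using exp_remainder[of "h * ln t"] mult_right_mono[OF e, of "(h * ln t)\<^sup>2"]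
    by (intro mult_left_mono) auto
  also have "\<dots> = h\<^sup>2 * ((t powr (a + \<eta>) + t powr (a - \<eta>)) * (ln t)\<^sup>2)"
    using assms by (simp add: powr_add powr_diff powr_minus field_simps)
  finally show ?thesis .
qed

text \<open>The integrand of the \<open>j\<close>-th derivative of the Gamma function at \<open>x\<close>.\<close>

definition Gamma_log_integrand :: "nat \<Rightarrow> real \<Rightarrow> real \<Rightarrow> real" where
  "Gamma_log_integrand j x t = t powr (x - 1) * ln t ^ j / exp t"

text \<open>
  Each further factor \<open>ln t\<close> costs an arbitrarily small change of the exponent, in either direction,
  and so stays within the range where the Gamma integral converges.
\<close>

lemma absolutely_integrable_Gamma_log_integrand:
  assumes "x > 0"
  shows "Gamma_log_integrand j x absolutely_integrable_on {0<..}"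
  using assms
proof (induction j arbitrary: x)
  case 0
  have "(\<lambda>t. t powr (x - 1) / exp t) integrable_on {0..}"
    using Gamma_integral_real[OF 0] by blast
  then have "(\<lambda>t. t powr (x - 1) / exp t) integrable_on {0<..}"
    by (rule integrable_spike_set) (auto intro: negligible_subset[of "{0}"])
  then have "(\<lambda>t. t powr (x - 1) / exp t) absolutely_integrable_on {0<..}"
    by (rule nonnegative_absolutely_integrable_1) auto
  then show ?case by (simp add: Gamma_log_integrand_def[abs_def])
next
  case (Suc j)
  let ?g = "\<lambda>t. (2 / x) * (\<bar>Gamma_log_integrand j (x + x/2) t\<bar> + \<bar>Gamma_log_integrand j (x - x/2) t\<bar>)"
  have pos: "x + x/2 > 0" "x - x/2 > 0" using Suc.prems by auto
  show ?case
  proof (rule measurable_bounded_by_integrable_imp_absolutely_integrable)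
    have "Gamma_log_integrand (Suc j) x \<in> borel_measurable borel"
      unfolding Gamma_log_integrand_def[abs_def] by measurable
    then show "Gamma_log_integrand (Suc j) x \<in> borel_measurable (lebesgue_on {0<..})"
      by (simp add: measurable_completion measurable_restrict_space1)
    show "{0<..} \<in> sets (lebesgue :: real measure)" by simp
    have abs: "(\<lambda>t. \<bar>Gamma_log_integrand j y t\<bar>) integrable_on {0<..}" if "y > 0" for y
      using Suc.IH[OF that] by (simp add: absolutely_integrable_on_def)
    show "?g integrable_on {0<..}"
      by (intro integrable_on_mult_right integrable_add abs pos)
    fix t :: real assume t: "t \<in> {0<..}"
    have "norm (Gamma_log_integrand (Suc j) x t) = \<bar>Gamma_log_integrand j x t\<bar> * \<bar>ln t\<bar>"
      by (simp add: Gamma_log_integrand_def abs_mult)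
    also have "\<dots> \<le> \<bar>Gamma_log_integrand j x t\<bar> * ((t powr (x/2) + t powr - (x/2)) / (x/2))"
      using t Suc.prems by (intro mult_left_mono abs_ln_le_powr) auto
    also have "\<dots> = ?g t"
    proof -
      have "t powr (x + x/2 - 1) = t powr (x - 1) * t powr (x/2)"
        "t powr (x - x/2 - 1) = t powr (x - 1) * t powr - (x/2)"
        by (simp_all flip: powr_add)
      then show ?thesis
        by (simp add: Gamma_log_integrand_def abs_mult) (simp add: field_simps)
    qed
    finally show "norm (Gamma_log_integrand (Suc j) x t) \<le> ?g t" .
  qed
qed

lemma DERIV_of_quadratic_remainder:
  fixes F :: "real \<Rightarrow> real"
  assumes "\<eta> > 0" and b: "\<And>h. \<bar>h\<bar> \<le> \<eta> \<Longrightarrow> \<bar>F (x + h) - F x - h * D\<bar> \<le> h\<^sup>2 * C"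
  shows "(F has_real_derivative D) (at x)"
  unfolding DERIV_def
proof (rule LIM_zero_cancel, rule Lim_null_comparison)
  show "((\<lambda>h. \<bar>h\<bar> * C) \<longlongrightarrow> 0) (at 0)"
    by (auto intro!: tendsto_eq_intros)
  show "eventually (\<lambda>h. norm ((F (x + h) - F x) / h - D) \<le> \<bar>h\<bar> * C) (at 0)"
    unfolding eventually_at
  proof (intro exI[of _ \<eta>] conjI ballI impI assms(1))
    fix h :: real assume h: "h \<noteq> 0 \<and> dist h 0 < \<eta>"
    then have "(F (x + h) - F x) / h - D = (F (x + h) - F x - h * D) / h"
      by (simp add: field_simps)
    then have "norm ((F (x + h) - F x) / h - D) \<le> h\<^sup>2 * C / \<bar>h\<bar>"
      using b[of h] h by (simp add: divide_right_mono)
    also have "\<dots> = \<bar>h\<bar> * C"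
      using h by (simp add: field_simps power2_eq_square)
    finally show "norm ((F (x + h) - F x) / h - D) \<le> \<bar>h\<bar> * C" .
  qed
qed

text \<open>
  Differentiation under the integral sign needs no limit theorem here, as the pointwise remainder is
  at most \<open>h\<^sup>2\<close> times an integrable function.
\<close>

lemma has_real_derivative_Gamma_log_integral:
  assumes x: "x > 0"
  shows "((\<lambda>x. integral {0<..} (Gamma_log_integrand j x)) has_real_derivative
            integral {0<..} (Gamma_log_integrand (Suc j) x)) (at x)"
proof (rule DERIV_of_quadratic_remainder)
  let ?\<eta> = "x/2"
  show "?\<eta> > 0" using x by simp
  fix h :: real assume h: "\<bar>h\<bar> \<le> ?\<eta>"
  have int: "Gamma_log_integrand j y integrable_on {0<..}"
      "(\<lambda>t. \<bar>Gamma_log_integrand j y t\<bar>) integrable_on {0<..}" if "y > 0" for j y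
    using absolutely_integrable_Gamma_log_integrand[OF that, of j] by (simp_all add: absolutely_integrable_on_def)
  let ?G = "\<lambda>t. \<bar>Gamma_log_integrand (j+2) (x + ?\<eta>) t\<bar> + \<bar>Gamma_log_integrand (j+2) (x - ?\<eta>) t\<bar>"
  let ?R = "\<lambda>t. Gamma_log_integrand j (x + h) t - Gamma_log_integrand j x t - h * Gamma_log_integrand (Suc j) x t"
  have pos: "x + h > 0" "x + x/2 > 0" "x - x/2 > 0" using h x by auto
  have R: "integral {0<..} (Gamma_log_integrand j (x + h)) - integral {0<..} (Gamma_log_integrand j x)
      - h * integral {0<..} (Gamma_log_integrand (Suc j) x) = integral {0<..} ?R"
    using pos x by (simp add: integral_diff integrable_diff int integrable_on_mult_right)
  have "norm (integral {0<..} ?R) \<le> integral {0<..} (\<lambda>t. h\<^sup>2 * ?G t)"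
  proof (rule integral_norm_bound_integral)
    show "?R integrable_on {0<..}" "(\<lambda>t. h\<^sup>2 * ?G t) integrable_on {0<..}"
      by (intro integrable_diff integrable_on_mult_right integrable_add int pos x)+
    fix t :: real assume t: "t \<in> {0<..}"
    have "?R t = (t powr (x - 1 + h) - t powr (x - 1) - h * (t powr (x - 1) * ln t)) * (ln t ^ j / exp t)"
      by (simp add: Gamma_log_integrand_def field_simps)
    then have "norm (?R t) = \<bar>t powr (x - 1 + h) - t powr (x - 1) - h * (t powr (x - 1) * ln t)\<bar>
        * (\<bar>ln t\<bar> ^ j / exp t)"
      by (simp add: abs_mult power_abs)
    also have "\<dots> \<le> h\<^sup>2 * ((t powr (x - 1 + ?\<eta>) + t powr (x - 1 - ?\<eta>)) * (ln t)\<^sup>2) * (\<bar>ln t\<bar> ^ j / exp t)"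
      using t h by (intro mult_right_mono powr_remainder) auto
    also have "\<dots> = h\<^sup>2 * ?G t"
      by (simp add: Gamma_log_integrand_def abs_mult power_abs power_add)
         (simp add: field_simps power2_eq_square)
    finally show "norm (?R t) \<le> h\<^sup>2 * ?G t" .
  qed
  then show "\<bar>integral {0<..} (Gamma_log_integrand j (x + h)) - integral {0<..} (Gamma_log_integrand j x)
      - h * integral {0<..} (Gamma_log_integrand (Suc j) x)\<bar> \<le> h\<^sup>2 * integral {0<..} ?G"
    unfolding R by (simp add: integral_mult_right)
qed

lemma integral_Gamma_log_integrand:
  assumes x: "x > 0"
  shows "integral {0<..} (Gamma_log_integrand 0 x) = Gamma x"
    and "integral {0<..} (Gamma_log_integrand 1 x) = deriv Gamma x"
    and "integral {0<..} (Gamma_log_integrand 2 x) = deriv (deriv Gamma) x"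
proof -
  have 0: "integral {0<..} (Gamma_log_integrand 0 x) = Gamma x" if "x > 0" for x
  proof -
    have "((\<lambda>t. t powr (x - 1) / exp t) has_integral Gamma x) {0<..}"
      using Gamma_integral_real[OF that]
      by (subst has_integral_spike_set_eq[of _ "{0..}"]) (auto intro: negligible_subset[of "{0}"])
    then show ?thesis
      by (simp add: Gamma_log_integrand_def[abs_def] integral_unique)
  qed
  have step: "deriv f x = integral {0<..} (Gamma_log_integrand (Suc j) x)"
    if "\<And>x. x > 0 \<Longrightarrow> integral {0<..} (Gamma_log_integrand j x) = f x" "x > 0" for f j x
  proof -
    have "eventually (\<lambda>y. f y = integral {0<..} (Gamma_log_integrand j y)) (nhds x)"
      using eventually_nhds_in_open[of "{0<..}" x] that by (auto elim!: eventually_mono)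
    then have "deriv f x = deriv (\<lambda>y. integral {0<..} (Gamma_log_integrand j y)) x"
      by (rule deriv_cong_ev) simp
    then show ?thesis
      using has_real_derivative_Gamma_log_integral[OF that(2)] by (simp add: DERIV_imp_deriv)
  qed
  have 1: "integral {0<..} (Gamma_log_integrand 1 x) = deriv Gamma x" if "x > 0" for x
    using step[of 0 Gamma x] 0 that by simp
  show "integral {0<..} (Gamma_log_integrand 0 x) = Gamma x" "integral {0<..} (Gamma_log_integrand 1 x) = deriv Gamma x"
       "integral {0<..} (Gamma_log_integrand 2 x) = deriv (deriv Gamma) x"
    using 0 1 step[of 1 "deriv Gamma" x] x by (simp_all add: numeral_2_eq_2)
qed

lemma powr_neg_image: "a > 0 \<Longrightarrow> (\<lambda>x::real. x powr - a) ` {0<..} = {0<..}"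
proof (intro equalityI subsetI)
  fix y :: real assume "a > 0" "y \<in> {0<..}"
  then show "y \<in> (\<lambda>x::real. x powr - a) ` {0<..}"
    by (intro image_eqI[of _ _ "y powr (- 1 / a)"]) (auto simp: powr_powr)
qed auto

text \<open>
  If \<open>y\<close> follows the Frechet distribution with shape \<open>a\<close>, then \<open>t = y powr - a\<close> is standard
  exponential and \<open>ln y = - ln t / a\<close>. The substitution turns the moments below into derivatives
  of the Gamma function.
\<close>

lemma frechet_expectation_power_log:
  assumes a: "a > 0" and x: "x > 0"
  shows "frechet_expectation a (\<lambda>y. y powr (- a * (x - 1)) * ln y ^ j)
           = (- 1 / a) ^ j * integral {0<..} (Gamma_log_integrand j x)"
proof -
  let ?g = "\<lambda>y::real. y powr - a" and ?g' = "\<lambda>y::real. - a * y powr (- a - 1)"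
  let ?f = "\<lambda>t. (- 1 / a) ^ j * Gamma_log_integrand j x t"
  let ?e = "\<lambda>y. y powr (- a * (x - 1)) * ln y ^ j * frechet_density a y"
  have "inj_on ?g {0<..}"
  proof (rule inj_on_inverseI)
    fix y :: real assume "y \<in> {0<..}"
    then show "(y powr - a) powr (- 1 / a) = y"
      using a by (simp add: powr_powr)
  qed
  moreover have "?f absolutely_integrable_on ?g ` {0<..}
      \<and> integral (?g ` {0<..}) ?f = (- 1 / a) ^ j * integral {0<..} (Gamma_log_integrand j x)"
    using absolutely_integrable_Gamma_log_integrand[OF x, of j] a
    by (simp add: powr_neg_image set_integrable_mult_right integral_mult_right)
  ultimately have *: "(\<lambda>y. \<bar>?g' y\<bar> * ?f (?g y)) absolutely_integrable_on {0<..}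
      \<and> integral {0<..} (\<lambda>y. \<bar>?g' y\<bar> * ?f (?g y)) = (- 1 / a) ^ j * integral {0<..} (Gamma_log_integrand j x)"
    by (subst has_absolute_integral_change_of_variables_1')
       (auto intro!: derivative_eq_intros simp: field_simps)
  have e: "\<bar>?g' y\<bar> * ?f (?g y) = ?e y" if "y \<in> {0<..}" for y
  proof -
    have "(- 1 / a) ^ j * (- a * ln y) ^ j = ln y ^ j"
      using a by (simp flip: power_mult_distrib)
    then show ?thesis
      using that a
      by (simp add: Gamma_log_integrand_def frechet_density_def ln_powr powr_powr abs_mult exp_minus field_simps)
  qed
  have int: "?e absolutely_integrable_on {0<..}"
    by (rule set_integrable_cong[THEN iffD1, OF refl refl e conjunct1[OF *]])
  moreover have "?e \<in> borel_measurable borel"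
    unfolding frechet_density_def[abs_def] by measurable
  ultimately have "set_integrable lborel {0<..} ?e"
    by (simp add: set_integrable_def integrable_completion)
  then have "frechet_expectation a (\<lambda>y. y powr (- a * (x - 1)) * ln y ^ j) = integral {0<..} ?e"
    unfolding frechet_expectation_def by (rule set_borel_integral_eq_integral)
  also have "\<dots> = integral {0<..} (\<lambda>y. \<bar>?g' y\<bar> * ?f (?g y))"
    by (rule integral_cong) (rule e[symmetric])
  finally show ?thesis using * by simp
qed

lemma frechet_moments:
  assumes a: "a > 0"
  shows "frechet_expectation a (\<lambda>y. y powr - a) = 1"
    and "frechet_expectation a (\<lambda>y. y powr - a * ln y) = (euler_mascheroni - 1) / a"
    and "frechet_expectation a (\<lambda>y. y powr - a * (ln y)\<^sup>2) = Gamma''2 / a\<^sup>2"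
    and "frechet_expectation a ln = euler_mascheroni / a"
proof -
  have d: "deriv Gamma (2::real) = 1 - euler_mascheroni"
  proof -
    have "(Gamma has_field_derivative Gamma 2 * Digamma 2) (at (2::real))"
      by (rule has_field_derivative_Gamma) auto
    moreover have "Digamma (2::real) = 1 - euler_mascheroni"
      using Digamma_plus1[of "1::real"] by simp
    ultimately show ?thesis
      using Gamma_fact[of 1, where 'a = real] by (simp add: DERIV_imp_deriv)
  qed
  have G2: "Gamma (2::real) = 1" using Gamma_fact[of 1, where 'a = real] by simp
  show "frechet_expectation a (\<lambda>y. y powr - a) = 1"
    using frechet_expectation_power_log[OF a, of 2 0] by (simp add: integral_Gamma_log_integrand G2)
  show "frechet_expectation a (\<lambda>y. y powr - a * ln y) = (euler_mascheroni - 1) / a"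
  proof -
    have "frechet_expectation a (\<lambda>y. y powr - a * ln y) = - ((1 - euler_mascheroni) / a)"
      using frechet_expectation_power_log[OF a, of 2 1] integral_Gamma_log_integrand(2)[of 2] by (simp add: d)
    then show ?thesis by (simp add: diff_divide_distrib)
  qed
  show "frechet_expectation a (\<lambda>y. y powr - a * (ln y)\<^sup>2) = Gamma''2 / a\<^sup>2"
    using frechet_expectation_power_log[OF a, of 2 2] by (simp add: integral_Gamma_log_integrand field_simps)
  have "frechet_expectation a ln = frechet_expectation a (\<lambda>y. y powr (- a * (1 - 1)) * ln y ^ 1)"
    unfolding frechet_expectation_def by (intro set_lebesgue_integral_cong) auto
  then show "frechet_expectation a ln = euler_mascheroni / a"
    using frechet_expectation_power_log[OF a, of 1 1] integral_Gamma_log_integrand(2)[of 1]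
    by (simp add: deriv_Gamma_1)
qed

section \<open>The likelihood equation\<close>

definition power_log_mean :: "nat \<Rightarrow> nat \<Rightarrow> (nat \<Rightarrow> real) \<Rightarrow> real \<Rightarrow> real" where
  "power_log_mean j k x a = sample_mean k x (\<lambda>y. y powr - a * ln y ^ j)"

lemma Psi_power_log_mean: "Psi k x a = 1 / a + power_log_mean 1 k x a / power_log_mean 0 k x a - sample_mean k x ln"
  by (simp add: Psi_def power_log_mean_def)

lemma power_log_mean_0_pos:
  assumes "k \<ge> 1" "\<And>i. i \<in> {1..k} \<Longrightarrow> x i > 0"
  shows "power_log_mean 0 k x a > 0"
proof -
  have "0 < (\<Sum>i=1..k. x i powr - a * ln (x i) ^ 0)"
    using assms by (intro sum_pos) (force dest: assms(2))+
  then show ?thesis using assms(1) by (simp add: power_log_mean_def sample_mean_def)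
qed

lemma sample_mean_bound:
  assumes "\<And>i. i \<in> {1..k} \<Longrightarrow> \<bar>f (x i)\<bar> \<le> g (x i)"
  shows "\<bar>sample_mean k x f\<bar> \<le> sample_mean k x g"
proof -
  have "\<bar>\<Sum>i=1..k. f (x i)\<bar> \<le> (\<Sum>i=1..k. g (x i))"
    using assms by (intro order.trans[OF sum_abs] sum_mono) auto
  then show ?thesis
    by (simp add: sample_mean_def abs_mult divide_right_mono)
qed

lemma sample_mean_add: "sample_mean k x (\<lambda>y. f y + g y) = sample_mean k x f + sample_mean k x g"
  by (simp add: sample_mean_def sum.distrib add_divide_distrib)

lemma sample_mean_diff: "sample_mean k x (\<lambda>y. f y - g y) = sample_mean k x f - sample_mean k x g"
  by (simp add: sample_mean_def sum_subtractf diff_divide_distrib)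

lemma sample_mean_cmult: "sample_mean k x (\<lambda>y. c * f y) = c * sample_mean k x f"
  by (simp add: sample_mean_def flip: sum_distrib_left)

lemma power_log_mean_0_remainder:
  assumes pos: "\<And>i. i \<in> {1..k} \<Longrightarrow> x i > 0" and h: "\<bar>h\<bar> \<le> \<delta>"
  shows "\<bar>power_log_mean 0 k x (a + h) - power_log_mean 0 k x a + h * power_log_mean 1 k x a\<bar>
           \<le> h\<^sup>2 * (power_log_mean 2 k x (a + \<delta>) + power_log_mean 2 k x (a - \<delta>))"
proof -
  have "\<bar>sample_mean k x (\<lambda>t. t powr - (a + h) - t powr - a + h * (t powr - a * ln t))\<bar>
      \<le> sample_mean k x (\<lambda>t. h\<^sup>2 * ((t powr - (a + \<delta>) + t powr - (a - \<delta>)) * (ln t)\<^sup>2))"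
    using powr_remainder[of _ "- h" \<delta> "- a"] pos h
    by (intro sample_mean_bound) (simp add: algebra_simps minus_diff_commute)
  then show ?thesis
    by (simp add: power_log_mean_def distrib_right sample_mean_add sample_mean_diff sample_mean_cmult)
qed

text \<open>
  The Taylor remainder of order two involves \<open>(ln t)\<^sup>3\<close>. One of the three logarithms is traded for
  \<open>t powr (\<delta>/2) + t powr - (\<delta>/2)\<close>, so that the bound is again in terms of \<open>power_log_mean 2\<close>, which
  condition (i) controls.
\<close>

lemma power_log_mean_1_remainder:
  assumes pos: "\<And>i. i \<in> {1..k} \<Longrightarrow> x i > 0" and h: "\<bar>h\<bar> \<le> \<delta> / 2" and \<delta>: "\<delta> > 0"
  shows "\<bar>power_log_mean 1 k x (a + h) - power_log_mean 1 k x a + h * power_log_mean 2 k x a\<bar>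
           \<le> 4 / \<delta> * (h\<^sup>2 * (power_log_mean 2 k x (a + \<delta>) + power_log_mean 2 k x (a - \<delta>)))"
proof -
  have "\<bar>(t powr (- a + - h) - t powr - a - (- h) * (t powr - a * ln t)) * ln t\<bar>
      \<le> 4 / \<delta> * (h\<^sup>2 * ((t powr (- a + \<delta>) + t powr (- a - \<delta>)) * (ln t)\<^sup>2))" if t: "t > 0" for t
  proof -
    \<comment> \<open>Half of \<open>\<delta>\<close> is spent on the remainder and the other half on the extra logarithm.\<close>
    define p where "p = t powr (\<delta>/2)"
    have p: "p > 0" "t powr - (\<delta>/2) = 1 / p"
      "t powr (- a + \<delta>) = t powr - a * p\<^sup>2" "t powr (- a - \<delta>) = t powr - a / p\<^sup>2"
      "t powr (- a + \<delta>/2) = t powr - a * p" "t powr (- a - \<delta>/2) = t powr - a / p"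
      using t by (auto simp: p_def powr_minus_divide powr_add powr_diff power2_eq_square simp flip: powr_add)
    have "\<bar>(t powr (- a + - h) - t powr - a - (- h) * (t powr - a * ln t)) * ln t\<bar>
        \<le> (h\<^sup>2 * ((t powr (- a + \<delta>/2) + t powr (- a - \<delta>/2)) * (ln t)\<^sup>2))
           * ((t powr (\<delta>/2) + t powr - (\<delta>/2)) / (\<delta>/2))"
      unfolding abs_mult[of _ "ln t"]
      using powr_remainder[OF t, of "- h" "\<delta>/2" "- a"] abs_ln_le_powr[OF t, of "\<delta>/2"] h \<delta>
      by (intro mult_mono) auto
    also have "\<dots> = (2 / \<delta> * (h\<^sup>2 * (t powr - a * (ln t)\<^sup>2))) * (p + 1 / p)\<^sup>2"
      unfolding p using \<delta> by (simp add: p_def[symmetric] power2_eq_square field_simps)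
    also have "\<dots> \<le> (2 / \<delta> * (h\<^sup>2 * (t powr - a * (ln t)\<^sup>2))) * (2 * (p\<^sup>2 + 1 / p\<^sup>2))"
    proof (rule mult_left_mono)
      have "0 \<le> (p - 1 / p)\<^sup>2" by simp
      then show "(p + 1 / p)\<^sup>2 \<le> 2 * (p\<^sup>2 + 1 / p\<^sup>2)"
        using p(1) by (simp add: power2_sum power2_diff power_divide)
    qed (use \<delta> in simp)
    also have "\<dots> = 4 / \<delta> * (h\<^sup>2 * ((t powr (- a + \<delta>) + t powr (- a - \<delta>)) * (ln t)\<^sup>2))"
      unfolding p by (simp add: field_simps)
    finally show ?thesis .
  qed
  then have "\<bar>sample_mean k x (\<lambda>t. t powr - (a + h) * ln t - t powr - a * ln t + h * (t powr - a * (ln t)\<^sup>2))\<bar>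
      \<le> sample_mean k x (\<lambda>t. 4 / \<delta> * (h\<^sup>2 * (t powr - (a + \<delta>) * (ln t)\<^sup>2 + t powr - (a - \<delta>) * (ln t)\<^sup>2)))"
    using pos by (intro sample_mean_bound) (simp add: algebra_simps power2_eq_square minus_diff_commute)
  then show ?thesis
    unfolding sample_mean_add sample_mean_diff sample_mean_cmult by (simp add: power_log_mean_def)
qed

text \<open>
  The ratio \<open>power_log_mean 1 / power_log_mean 0\<close> is a weighted mean of the \<open>ln (x i)\<close>, and increasing the exponent
  moves weight to the smaller observations. Formally, the cross difference is half of a double sum
  over pairs \<open>(i, j)\<close> whose terms are products of two factors with the sign of \<open>x i - x j\<close>.
\<close>

lemma power_log_mean_cross_difference:
  assumes pos: "\<And>i. i \<in> {1..k} \<Longrightarrow> x i > 0" and ab: "a < b"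
  shows "power_log_mean 1 k x b * power_log_mean 0 k x a \<le> power_log_mean 1 k x a * power_log_mean 0 k x b"
    and "\<not> all_equal k x \<Longrightarrow> power_log_mean 1 k x b * power_log_mean 0 k x a < power_log_mean 1 k x a * power_log_mean 0 k x b"
proof -
  let ?A = "\<lambda>i. x i powr - a" and ?B = "\<lambda>i. x i powr - b" and ?l = "\<lambda>i. ln (x i)"
  let ?d = "\<lambda>(i, j). (?l i - ?l j) * (?A i * ?B j - ?B i * ?A j)"
  let ?D = "power_log_mean 1 k x a * power_log_mean 0 k x b - power_log_mean 1 k x b * power_log_mean 0 k x a"
  define K where "K = {1..k} \<times> {1..k}"
  have prod: "(\<Sum>i=1..k. f i) * (\<Sum>i=1..k. g i) = (\<Sum>(i,j)\<in>K. f i * g j)" for f g :: "nat \<Rightarrow> real"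
    by (simp add: K_def sum_product sum.cartesian_product)
  have swap: "(\<Sum>(i,j)\<in>K. f i j) = (\<Sum>(i,j)\<in>K. f j i)" for f :: "nat \<Rightarrow> nat \<Rightarrow> real"
    unfolding K_def sum.cartesian_product[symmetric] by (rule sum.swap)
  have "(real k)\<^sup>2 * ?D = (\<Sum>(i,j)\<in>K. ?A i * ?l i * ?B j) - (\<Sum>(i,j)\<in>K. ?B i * ?l i * ?A j)"
    unfolding prod[symmetric] by (simp add: power_log_mean_def sample_mean_def power2_eq_square field_simps)
  moreover have "(real k)\<^sup>2 * ?D = (\<Sum>(i,j)\<in>K. ?A j * ?l j * ?B i) - (\<Sum>(i,j)\<in>K. ?B j * ?l j * ?A i)"
    unfolding swap[of "\<lambda>j i. ?A j * ?l j * ?B i"] swap[of "\<lambda>j i. ?B j * ?l j * ?A i"] calculation ..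
  ultimately have "2 * ((real k)\<^sup>2 * ?D)
      = (\<Sum>p\<in>K. (\<lambda>(i,j). ?A i * ?l i * ?B j) p - (\<lambda>(i,j). ?B i * ?l i * ?A j) p
          + ((\<lambda>(i,j). ?A j * ?l j * ?B i) p - (\<lambda>(i,j). ?B j * ?l j * ?A i) p))"
    unfolding sum.distrib sum_subtractf by linarith
  also have "\<dots> = sum ?d K"
    by (rule sum.cong) (auto simp: algebra_simps)
  finally have D: "2 * ((real k)\<^sup>2 * ?D) = sum ?d K" .
  have pos_term: "?d (i, j) > 0" if ij: "(i, j) \<in> K" "x i > x j" for i j
  proof -
    have xi: "x i > 0" "x j > 0" using ij pos by (auto simp: K_def)
    have "?A i * ?B j - ?B i * ?A j
        = x i powr - b * x j powr - b * (x i powr (b - a) - x j powr (b - a))"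
      using xi by (simp add: powr_diff powr_minus field_simps)
    also have "\<dots> > 0"
      using xi ij(2) ab powr_less_mono2[of "b - a" "x j" "x i"] by simp
    finally show ?thesis using xi ij(2) by simp
  qed
  have sym: "?d (i, j) = ?d (j, i)" for i j by (simp add: algebra_simps)
  have pos_term': "?d p > 0" if "p \<in> K" "x (fst p) \<noteq> x (snd p)" for p
    using pos_term[of "fst p" "snd p"] pos_term[of "snd p" "fst p"] sym[of "fst p" "snd p"] that
    by (cases p) (force simp: K_def neq_iff)
  have nonneg: "?d p \<ge> 0" if "p \<in> K" for p
    using pos_term'[OF that] by (cases "x (fst p) = x (snd p)") (auto simp: case_prod_beta)
  have "sum ?d K \<ge> 0" using nonneg by (rule sum_nonneg)
  then show "power_log_mean 1 k x b * power_log_mean 0 k x a \<le> power_log_mean 1 k x a * power_log_mean 0 k x b"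
    unfolding D[symmetric] by (cases "k = 0") (auto simp: zero_le_mult_iff power_log_mean_def sample_mean_def)
  assume "\<not> all_equal k x"
  then obtain p where p: "p \<in> K" "x (fst p) \<noteq> x (snd p)"
    by (auto simp: all_equal_def K_def)
  have "sum ?d K > 0"
    using p pos_term'[OF p] nonneg by (intro sum_pos2[of _ p]) (auto simp: K_def)
  then show "power_log_mean 1 k x b * power_log_mean 0 k x a < power_log_mean 1 k x a * power_log_mean 0 k x b"
    unfolding D[symmetric] by (auto simp: zero_less_mult_iff)
qed

text \<open>
  The ratio of means in \<open>Psi\<close> decreases, so \<open>Psi\<close> falls at least as fast as \<open>1 / \<alpha>\<close>, whatever
  the sample.
\<close>

lemma Psi_decrease:
  assumes k: "k \<ge> 1" and pos: "\<And>i. i \<in> {1..k} \<Longrightarrow> x i > 0" and ab: "a \<le> b"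
  shows "1 / a - 1 / b \<le> Psi k x a - Psi k x b"
proof (cases "a = b")
  case False
  then have "a < b" using ab by simp
  from power_log_mean_cross_difference(1)[OF pos this]
  have "power_log_mean 1 k x b / power_log_mean 0 k x b \<le> power_log_mean 1 k x a / power_log_mean 0 k x a"
    using power_log_mean_0_pos[of k x a, OF k pos] power_log_mean_0_pos[of k x b, OF k pos] by (simp add: field_simps)
  then show ?thesis by (simp add: Psi_power_log_mean)
qed simp

lemma Psi_strict_antimono:
  assumes k: "k \<ge> 1" and pos: "\<And>i. i \<in> {1..k} \<Longrightarrow> x i > 0" and "0 < a" "a < b"
  shows "Psi k x b < Psi k x a"
  using Psi_decrease[of k x a b, OF k pos] frac_less2[of 1 1 a b] assms by simp

text \<open>
  At exponent \<open>0\<close> the ratio of means equals the mean of the logarithms, and for a sample that is not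
  constant it is strictly smaller at exponent \<open>1\<close>. The gap \<open>d\<close> yields explicit points \<open>a\<close> and
  \<open>b\<close> at which \<open>Psi\<close> is nonnegative and nonpositive.
\<close>

lemma ex1_Psi_zero:
  assumes k: "k \<ge> 1" and pos: "\<And>i. i \<in> {1..k} \<Longrightarrow> x i > 0" and ne: "\<not> all_equal k x"
  shows "\<exists>!a. a > 0 \<and> Psi k x a = 0"
proof (rule ex_ex1I)
  let ?r = "\<lambda>a. power_log_mean 1 k x a / power_log_mean 0 k x a"
  have p0: "power_log_mean 0 k x a > 0" for a using power_log_mean_0_pos[of k x a, OF k pos] .
  define l where "l = sample_mean k x ln"
  have "(\<Sum>i=1..k. x i powr - 0 * ln (x i) ^ j) = (\<Sum>i=1..k. ln (x i) ^ j)" for j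
    by (intro sum.cong refl) (use pos in force)
  from this[of 0] this[of 1] have "power_log_mean 1 k x 0 = l" "power_log_mean 0 k x 0 = 1"
    using k by (simp_all add: power_log_mean_def sample_mean_def l_def)
  then have r1: "?r 1 < l"
    using power_log_mean_cross_difference(2)[OF pos _ ne, of 0 1] p0[of 1] by (simp add: field_simps)
  define d where "d = l - ?r 1"
  define a where "a = 1 / (1 + d)"
  define b where "b = max 1 (1 / d)"
  have d: "d > 0" using r1 by (simp add: d_def)
  have "0 < a" "a \<le> 1" "1 \<le> b" "1 / b \<le> d"
    using d by (auto simp: a_def b_def max_def field_simps)
  then have ab: "0 < a" "a \<le> b" by auto
  from Psi_decrease[of k x a 1, OF k pos \<open>a \<le> 1\<close>] have "Psi k x a \<ge> 0"
    using d by (simp add: Psi_power_log_mean a_def d_def l_def)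
  from \<open>1 / b \<le> d\<close> Psi_decrease[of k x 1 b, OF k pos \<open>1 \<le> b\<close>] have "Psi k x b \<le> 0"
    by (simp add: Psi_power_log_mean d_def l_def)
  have nz: "x i \<noteq> 0" if "i \<in> {1..k}" for i using pos[OF that] by simp
  have "continuous_on {a..b} (power_log_mean j k x)" for j
    unfolding power_log_mean_def[abs_def] sample_mean_def by (intro continuous_intros ballI nz)
  then have "continuous_on {a..b} (\<lambda>a. Psi k x a)"
    unfolding Psi_power_log_mean
  proof (intro continuous_intros ballI)
    fix y assume "y \<in> {a..b}"
    then show "y \<noteq> 0" "power_log_mean 0 k x y \<noteq> 0" using ab(1) p0[of y] by auto
  qed
  from IVT2'[of "Psi k x" b 0 a, OF \<open>Psi k x b \<le> 0\<close> \<open>0 \<le> Psi k x a\<close> ab(2) this]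
  show "\<exists>a>0. Psi k x a = 0" using ab(1) by (meson less_le_trans)
  fix a b assume "a > 0 \<and> Psi k x a = 0" "b > 0 \<and> Psi k x b = 0"
  then show "a = b"
    using Psi_strict_antimono[of k x a b, OF k pos] Psi_strict_antimono[of k x b a, OF k pos]
    by (cases a b rule: linorder_cases) auto
qed

text \<open>
  This bound gives the consistency of the shape estimator and its rate at once: a small score at the
  true parameter \<open>b\<close> forces the root \<open>a\<close> to be near.
\<close>

lemma Psi_zero_close:
  assumes k: "k \<ge> 1" and pos: "\<And>i. i \<in> {1..k} \<Longrightarrow> x i > 0" and ab: "0 < a" "0 < b"
    and "Psi k x a = 0"
  shows "\<bar>1 / a - 1 / b\<bar> \<le> \<bar>Psi k x b\<bar>"
  using Psi_decrease[of k x a b, OF k pos] Psi_decrease[of k x b a, OF k pos] assms(5)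
    frac_le[of 1 1 a b] frac_le[of 1 1 b a] ab
  by (cases a b rule: le_cases) auto

section \<open>Expansion of the root of the likelihood equation\<close>

lemma bigo_one_mult_null:
  fixes f g :: "'i \<Rightarrow> real"
  assumes "f \<in> O[F](\<lambda>_. 1)" "(g \<longlongrightarrow> 0) F"
  shows "((\<lambda>n. f n * g n) \<longlongrightarrow> 0) F"
proof -
  have "g \<in> o[F](\<lambda>_. 1)" using assms(2) by (intro smalloI_tendsto) auto
  then have "(\<lambda>n. f n * g n) \<in> o[F](\<lambda>_. 1 * 1)"
    by (intro landau_o.big_small_mult assms(1))
  from smalloD_tendsto[OF this] show ?thesis by simp
qed

lemma bigo_one_mult:
  fixes f g :: "'i \<Rightarrow> real"
  assumes "f \<in> O[F](\<lambda>_. 1)" "g \<in> O[F](\<lambda>_. 1)"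
  shows "(\<lambda>n. f n * g n) \<in> O[F](\<lambda>_. 1)"
  using landau_o.big_mult[OF assms] by simp

lemma tendsto_imp_bigo_one:
  fixes f :: "'i \<Rightarrow> real"
  assumes "(f \<longlongrightarrow> c) F"
  shows "f \<in> O[F](\<lambda>_. 1)"
  using assms by (intro bigoI_tendsto) auto

text \<open>
  The analytic core, for deterministic sequences (or any filter). Here \<open>a\<close> is a root of the
  likelihood equation, \<open>s0, s1, s2\<close> stand for \<open>power_log_mean 0, 1, 2\<close> at the true shape \<open>a0\<close>, \<open>t0, t1\<close>
  for \<open>power_log_mean 0, 1\<close> at \<open>a\<close>, and \<open>l\<close> for the mean of the logarithms. By \<open>close\<close> the sequence
  \<open>v (a - a0)\<close> is bounded, so all quadratic terms vanish after multiplication by \<open>v\<close>, and the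
  linearised equation can be solved for \<open>v (a - a0)\<close>.
\<close>

lemma mle_expansion:
  fixes v a s0 s1 s2 t0 t1 l T :: "'i \<Rightarrow> real" and a0 \<delta> C :: real
  defines "\<gamma> \<equiv> euler_mascheroni :: real"
  defines "G1 \<equiv> \<lambda>n. v n * (s1 n - (\<gamma> - 1) / a0)"
    and "G2 \<equiv> \<lambda>n. v n * (s0 n - 1)"
    and "G3 \<equiv> \<lambda>n. v n * (l n - \<gamma> / a0)"
  assumes a0: "a0 > 0" and \<delta>: "\<delta> > 0"
    and v: "\<And>n. v n > 0" "filterlim v at_top F"
    and pos: "\<And>n. a n > 0" "\<And>n. s0 n > 0" "\<And>n. t0 n > 0"
    and bdd: "G1 \<in> O[F](\<lambda>_. 1)" "G2 \<in> O[F](\<lambda>_. 1)" "G3 \<in> O[F](\<lambda>_. 1)" "T \<in> O[F](\<lambda>_. 1)"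
    and s2: "(s2 \<longlongrightarrow> Gamma''2 / a0\<^sup>2) F"
    and zero: "\<And>n. 1 / a n + t1 n / t0 n - l n = 0"
    and close: "\<And>n. \<bar>1 / a n - 1 / a0\<bar> \<le> \<bar>1 / a0 + s1 n / s0 n - l n\<bar>"
    and R0: "\<And>n. \<bar>a n - a0\<bar> \<le> \<delta> \<Longrightarrow>
               \<bar>t0 n - s0 n + (a n - a0) * s1 n\<bar> \<le> (a n - a0)\<^sup>2 * T n"
    and R1: "\<And>n. \<bar>a n - a0\<bar> \<le> \<delta> \<Longrightarrow>
               \<bar>t1 n - s1 n + (a n - a0) * s2 n\<bar> \<le> C * ((a n - a0)\<^sup>2 * T n)"
  shows "((\<lambda>n. v n * (a n - a0)
            - 6 / pi\<^sup>2 * (a0\<^sup>2 * G1 n + a0 * (1 - \<gamma>) * G2 n - a0\<^sup>2 * G3 n)) \<longlongrightarrow> 0) F"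
    and "((\<lambda>n. v n * (t0 n powr (- 1 / a n) - 1)
            - 6 / pi\<^sup>2 * ((\<gamma> - 1) * G1 n + - (Gamma''2 + 1) / a0 * G2 n + (1 - \<gamma>) * G3 n)) \<longlongrightarrow> 0) F"
proof -
  define h where "h = (\<lambda>n. a n - a0)"
  define W where "W = (\<lambda>n. G1 n + (1 - \<gamma>) / a0 * G2 n - G3 n)"
  define D where "D = pi\<^sup>2 / (6 * a0\<^sup>2)"
  define r0 where "r0 = (\<lambda>n. v n * (t0 n - s0 n + h n * s1 n))"
  define r1 where "r1 = (\<lambda>n. v n * (t1 n - s1 n + h n * s2 n))"
  have D: "D > 0" using a0 by (simp add: D_def)
  have iv: "((\<lambda>n. inverse (v n)) \<longlongrightarrow> 0) F"
    using v(2) tendsto_inverse_0_at_top by blast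
  have from_G: "(f \<longlongrightarrow> c) F" if "(\<lambda>n. v n * (f n - c)) \<in> O[F](\<lambda>_. 1)" for f :: "'i \<Rightarrow> real" and c
  proof (rule LIM_zero_cancel)
    have "f n - c = v n * (f n - c) * inverse (v n)" for n
      using v(1)[of n] by (simp add: field_simps)
    with bigo_one_mult_null[OF that iv] show "((\<lambda>n. f n - c) \<longlongrightarrow> 0) F" by simp
  qed
  have s0: "(s0 \<longlongrightarrow> 1) F" and s1: "(s1 \<longlongrightarrow> (\<gamma> - 1) / a0) F" and l: "(l \<longlongrightarrow> \<gamma> / a0) F"
    using bdd(1-3) by (intro from_G; simp add: G1_def G2_def G3_def)+

  \<comment> \<open>The scaled score at \<open>a0\<close> is \<open>W\<close> up to a null sequence, as its limit vanishes:
      \<open>1 + (\<gamma> - 1) - \<gamma> = 0\<close>.\<close>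
  define \<psi> where "\<psi> = (\<lambda>n. 1 / a0 + s1 n / s0 n - l n)"
  have W_bdd: "W \<in> O[F](\<lambda>_. 1)"
    unfolding W_def by (intro sum_in_bigo bigo_one_mult bdd tendsto_imp_bigo_one[OF tendsto_const])
  have v_score: "v n * (s1 n + (1 / a0 - l n) * s0 n) = W n - G2 n * G3 n * inverse (v n)" for n
    using v(1)[of n] a0 by (simp add: W_def G1_def G2_def G3_def field_simps)
  have GG: "((\<lambda>n. G2 n * G3 n * inverse (v n)) \<longlongrightarrow> 0) F"
    by (intro bigo_one_mult_null bigo_one_mult bdd iv)
  have "(\<lambda>n. (W n - G2 n * G3 n * inverse (v n)) * inverse (s0 n)) \<in> O[F](\<lambda>_. 1)"
    by (intro bigo_one_mult sum_in_bigo W_bdd tendsto_imp_bigo_one[OF GG]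
        tendsto_imp_bigo_one[OF tendsto_inverse[OF s0]]) simp
  also have "(\<lambda>n. (W n - G2 n * G3 n * inverse (v n)) * inverse (s0 n)) = (\<lambda>n. v n * (\<psi> n - 0))"
  proof
    fix n show "(W n - G2 n * G3 n * inverse (v n)) * inverse (s0 n) = v n * (\<psi> n - 0)"
      unfolding v_score[symmetric] \<psi>_def using pos(2)[of n] by (simp add: field_simps)
  qed
  finally have v\<psi>: "(\<lambda>n. v n * (\<psi> n - 0)) \<in> O[F](\<lambda>_. 1)" .
  have v_inv: "(\<lambda>n. v n * (1 / a n - 1 / a0)) \<in> O[F](\<lambda>_. 1)"
  proof (rule landau_o.big.in_cong[THEN iffD1, OF _ landau_o.big_trans[OF _ v\<psi>]])
    show "(\<lambda>n. v n * (1 / a n - 1 / a0)) \<in> O[F](\<lambda>n. v n * (\<psi> n - 0))"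
      using close v(1)
      by (intro landau_o.bigI[of 1] always_eventually) (auto simp: abs_mult \<psi>_def mult_left_mono)
  qed auto
  have "((\<lambda>n. 1 / (1 / a n)) \<longlongrightarrow> 1 / (1 / a0)) F"
    using a0 by (intro tendsto_divide tendsto_const from_G v_inv) auto
  then have a: "(a \<longlongrightarrow> a0) F" by simp
  have h: "(h \<longlongrightarrow> 0) F" unfolding h_def using a by (simp add: LIM_zero)
  have "(\<lambda>n. - (v n * (1 / a n - 1 / a0)) * (a n * a0)) \<in> O[F](\<lambda>_. 1)"
    using v_inv by (intro bigo_one_mult tendsto_imp_bigo_one[OF a] tendsto_imp_bigo_one[OF tendsto_const]) simp
  also have "(\<lambda>n. - (v n * (1 / a n - 1 / a0)) * (a n * a0)) = (\<lambda>n. v n * h n)"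
  proof
    fix n show "- (v n * (1 / a n - 1 / a0)) * (a n * a0) = v n * h n"
      using a0 pos(1)[of n] by (simp add: h_def field_simps)
  qed
  finally have vh: "(\<lambda>n. v n * h n) \<in> O[F](\<lambda>_. 1)" .

  have "((\<lambda>n. v n * h n * T n * h n) \<longlongrightarrow> 0) F"
    by (intro bigo_one_mult_null bigo_one_mult vh bdd h)
  then have vhhT: "((\<lambda>n. v n * (h n)\<^sup>2 * T n) \<longlongrightarrow> 0) F"
    by (simp add: power2_eq_square mult_ac)
  \<comment> \<open>The remainders are quadratic in \<open>h\<close>, and \<open>v h\<^sup>2 = (v h) h\<close> vanishes.\<close>
  have near: "eventually (\<lambda>n. \<bar>h n\<bar> \<le> \<delta>) F"
    using tendstoD[OF h \<delta>] by (auto elim!: eventually_mono)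
  have r0: "(r0 \<longlongrightarrow> 0) F"
  proof (rule Lim_null_comparison[OF _ vhhT])
    show "eventually (\<lambda>n. norm (r0 n) \<le> v n * (h n)\<^sup>2 * T n) F"
      using near
    proof eventually_elim
      case (elim n)
      then show ?case
        using R0[of n] v(1)[of n] by (simp add: r0_def h_def abs_mult mult.assoc)
    qed
  qed
  have r1: "(r1 \<longlongrightarrow> 0) F"
  proof (rule Lim_null_comparison)
    show "((\<lambda>n. C * (v n * (h n)\<^sup>2 * T n)) \<longlongrightarrow> 0) F"
      using tendsto_mult_left[OF vhhT, of C] by simp
    show "eventually (\<lambda>n. norm (r1 n) \<le> C * (v n * (h n)\<^sup>2 * T n)) F"
      using near
    proof eventually_elim
      case (elim n)
      then have "v n * \<bar>t1 n - s1 n + h n * s2 n\<bar> \<le> v n * (C * ((h n)\<^sup>2 * T n))"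
        using R1[of n] v(1)[of n] by (intro mult_left_mono) (auto simp: h_def)
      then show ?case
        using v(1)[of n] by (simp add: r1_def abs_mult mult_ac)
    qed
  qed

  define q where "q = (\<lambda>n. v n * (t0 n - 1))"
  have q_eq: "q n = G2 n - v n * h n * s1 n + r0 n" for n
    by (simp add: q_def G2_def r0_def algebra_simps)
  have q: "q \<in> O[F](\<lambda>_. 1)"
    unfolding q_eq by (intro sum_in_bigo bigo_one_mult bdd vh tendsto_imp_bigo_one[OF s1] tendsto_imp_bigo_one[OF r0])
  have t0: "(t0 \<longlongrightarrow> 1) F" using q unfolding q_def by (rule from_G)

  \<comment> \<open>Multiplying the likelihood equation by \<open>t0\<close> and expanding makes it linear in \<open>h\<close> with the
      random slope \<open>d\<close>. The limit \<open>D\<close> of the slope is the Fisher information for the shape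
      with the scale profiled out.\<close>
  define d where "d = (\<lambda>n. s2 n + t0 n / (a0 * a n) + (1 / a0 - l n) * s1 n)"
  have "(d \<longlongrightarrow> Gamma''2 / a0\<^sup>2 + 1 / (a0 * a0) + (1 / a0 - \<gamma> / a0) * ((\<gamma> - 1) / a0)) F"
    unfolding d_def using a0 by (intro tendsto_intros s2 t0 a l s1) auto
  also have "Gamma''2 / a0\<^sup>2 + 1 / (a0 * a0) + (1 / a0 - \<gamma> / a0) * ((\<gamma> - 1) / a0) = D"
    using a0 by (simp add: Gamma''2_eq \<gamma>_def D_def field_simps power2_eq_square)
  finally have d: "(d \<longlongrightarrow> D) F" .
  have eq: "v n * h n * d n - W n = r1 n + (1 / a0 - l n) * r0 n - G2 n * G3 n * inverse (v n)" for n
  proof -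
    have "t1 n + (1 / a n - l n) * t0 n = 0"
      using zero[of n] pos(3)[of n] by (simp add: field_simps)
    moreover have "1 / a n = 1 / a0 - h n / (a0 * a n)"
      using a0 pos(1)[of n] by (simp add: h_def field_simps)
    ultimately have "t1 n + (1 / a0 - l n) * t0 n = h n * (t0 n / (a0 * a n))"
      by (simp add: algebra_simps)
    then have "v n * (t1 n + (1 / a0 - l n) * t0 n) = v n * h n * (t0 n / (a0 * a n))"
      by simp
    moreover have dist: "v n * (x + (1 / a0 - l n) * y) = v n * x + (1 / a0 - l n) * (v n * y)" for x y
      by (simp only: distrib_left mult.left_commute)
    ultimately have 1: "v n * t1 n + (1 / a0 - l n) * (v n * t0 n) = v n * h n * (t0 n / (a0 * a n))"
      by metis
    have 2: "v n * t1 n = v n * s1 n - v n * h n * s2 n + r1 n"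
      "v n * t0 n = v n * s0 n - v n * h n * s1 n + r0 n"
      by (simp_all add: r1_def r0_def algebra_simps)
    have "vh * (s2' + e + c * s1') - (vs1 + c * vs0) = r1' + c * r0'"
      if "vt1 + c * vt0 = vh * e" "vt1 = vs1 - vh * s2' + r1'" "vt0 = vs0 - vh * s1' + r0'"
      for vh s2' e c s1' vs1 vs0 r1' r0' vt1 vt0 :: real
      using that by (simp add: algebra_simps)
    from this[OF 1 2] show ?thesis
      using v_score[of n] unfolding d_def dist by linarith
  qed
  have lin: "((\<lambda>n. v n * h n - W n / D) \<longlongrightarrow> 0) F"
  proof -
    have "((\<lambda>n. v n * h n * (D - d n) + (v n * h n * d n - W n)) \<longlongrightarrow> 0 + (0 + (1 / a0 - \<gamma> / a0) * 0 - 0)) F"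
      unfolding eq
      by (intro tendsto_add tendsto_diff tendsto_mult bigo_one_mult_null vh r1 r0 GG l tendsto_const)
         (use tendsto_diff[OF tendsto_const d, of D] in simp)
    from tendsto_divide[OF this tendsto_const[of D]] D
    show ?thesis by (simp add: field_simps)
  qed
  then show "((\<lambda>n. v n * (a n - a0)
            - 6 / pi\<^sup>2 * (a0\<^sup>2 * G1 n + a0 * (1 - \<gamma>) * G2 n - a0\<^sup>2 * G3 n)) \<longlongrightarrow> 0) F"
  proof -
    have "W n / D = 6 / pi\<^sup>2 * (a0\<^sup>2 * G1 n + a0 * (1 - \<gamma>) * G2 n - a0\<^sup>2 * G3 n)" for n
      using a0 by (simp add: W_def D_def field_simps power2_eq_square)
    with lin show ?thesis by (simp add: h_def)
  qed

  \<comment> \<open>The scale estimator is \<open>exp z\<close>, where \<open>z\<close> is of order \<open>1 / v\<close>; both \<open>ln\<close> and \<open>exp\<close> are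
      replaced by their tangents.\<close>
  define z where "z = (\<lambda>n. - (1 / a n) * ln (t0 n))"
  have ln0: "((\<lambda>n. v n * ln (t0 n) - q n) \<longlongrightarrow> 0) F"
  proof (rule Lim_null_comparison)
    have "((\<lambda>n. \<bar>q n\<bar> * (2 * \<bar>t0 n - 1\<bar>)) \<longlongrightarrow> 0) F"
      using q by (intro bigo_one_mult_null) (auto intro!: tendsto_eq_intros t0)
    then show "((\<lambda>n. 2 * \<bar>q n\<bar> * \<bar>t0 n - 1\<bar>) \<longlongrightarrow> 0) F" by (simp add: mult_ac)
    have "eventually (\<lambda>n. \<bar>t0 n - 1\<bar> < 1/2) F"
      using tendstoD[OF t0, of "1/2"] by (simp add: dist_real_def)
    then show "eventually (\<lambda>n. norm (v n * ln (t0 n) - q n) \<le> 2 * \<bar>q n\<bar> * \<bar>t0 n - 1\<bar>) F"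
    proof eventually_elim
      case (elim n)
      have "norm (v n * ln (t0 n) - q n) = v n * \<bar>ln (1 + (t0 n - 1)) - (t0 n - 1)\<bar>"
        using v(1)[of n] by (simp add: q_def abs_mult flip: right_diff_distrib)
      also have "\<dots> \<le> v n * (2 * (t0 n - 1)\<^sup>2)"
        using elim v(1)[of n] by (intro mult_left_mono abs_ln_one_plus_x_minus_x_bound) auto
      also have "\<dots> = 2 * \<bar>q n\<bar> * \<bar>t0 n - 1\<bar>"
        using v(1)[of n] by (simp add: q_def abs_mult power2_eq_square mult.assoc)
      finally show ?case .
    qed
  qed
  have ia: "((\<lambda>n. - (1 / a n)) \<longlongrightarrow> - (1 / a0)) F"
    using a0 by (intro tendsto_intros a) auto
  have vz_eq: "v n * z n = - (1 / a n) * ((v n * ln (t0 n) - q n) + q n)" for n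
    by (simp add: z_def)
  have vz: "(\<lambda>n. v n * z n) \<in> O[F](\<lambda>_. 1)"
    unfolding vz_eq by (intro bigo_one_mult sum_in_bigo tendsto_imp_bigo_one[OF ia] tendsto_imp_bigo_one[OF ln0] q)
  have z: "(z \<longlongrightarrow> 0) F"
    using from_G[of z 0] vz by simp
  have expz: "((\<lambda>n. v n * (exp (z n) - 1 - z n)) \<longlongrightarrow> 0) F"
  proof (rule Lim_null_comparison)
    have "((\<lambda>n. \<bar>v n * z n\<bar> * (exp \<bar>z n\<bar> * \<bar>z n\<bar>)) \<longlongrightarrow> 0) F"
    proof (rule bigo_one_mult_null)
      show "(\<lambda>n. \<bar>v n * z n\<bar>) \<in> O[F](\<lambda>_. 1)" using vz by simp
      show "((\<lambda>n. exp \<bar>z n\<bar> * \<bar>z n\<bar>) \<longlongrightarrow> 0) F"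
        by (auto intro!: tendsto_eq_intros z)
    qed
    then show "((\<lambda>n. \<bar>v n * z n\<bar> * (exp \<bar>z n\<bar> * \<bar>z n\<bar>)) \<longlongrightarrow> 0) F" .
    show "eventually (\<lambda>n. norm (v n * (exp (z n) - 1 - z n)) \<le> \<bar>v n * z n\<bar> * (exp \<bar>z n\<bar> * \<bar>z n\<bar>)) F"
    proof (rule always_eventually, rule allI)
      fix n
      have "norm (v n * (exp (z n) - 1 - z n)) \<le> v n * (exp \<bar>z n\<bar> * (z n)\<^sup>2)"
        using v(1)[of n] exp_remainder[of "z n"] by (simp add: abs_mult)
      then show "norm (v n * (exp (z n) - 1 - z n)) \<le> \<bar>v n * z n\<bar> * (exp \<bar>z n\<bar> * \<bar>z n\<bar>)"
        using v(1)[of n] by (simp add: abs_mult power2_eq_square mult_ac)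
    qed
  qed
  have key: "v n * (t0 n powr (- 1 / a n) - 1) - (- (1 / a0) * (G2 n + (1 - \<gamma>) / a0 * (W n / D)))
      = v n * (exp (z n) - 1 - z n) + - (1 / a n) * (v n * ln (t0 n) - q n)
        + q n * (- (1 / a n) - - (1 / a0))
        + (1 / a0) * (v n * h n * (s1 n - (\<gamma> - 1) / a0) + (\<gamma> - 1) / a0 * (v n * h n - W n / D) - r0 n)" for n
  proof -
    have "t0 n powr (- 1 / a n) = exp (z n)"
      using pos(3)[of n] by (simp add: powr_def z_def)
    moreover have "v n * z n = - (1 / a n) * (v n * ln (t0 n))" by (simp add: z_def)
    moreover have G2: "G2 n = q n + v n * h n * s1 n - r0 n" by (simp add: q_eq)
    ultimately show ?thesis
      unfolding G2 by (simp add: algebra_simps diff_divide_distrib add_divide_distrib)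
  qed
  have "((\<lambda>n. v n * (t0 n powr (- 1 / a n) - 1) - (- (1 / a0) * (G2 n + (1 - \<gamma>) / a0 * (W n / D))))
      \<longlongrightarrow> 0 + - (1 / a0) * 0 + 0 + (1 / a0) * (0 + (\<gamma> - 1) / a0 * 0 - 0)) F"
    unfolding key
    by (intro tendsto_add tendsto_mult tendsto_diff bigo_one_mult_null expz ia ln0 q vh lin r0 tendsto_const)
       (use LIM_zero[OF ia] LIM_zero[OF s1] in simp_all)
  then have "((\<lambda>n. v n * (t0 n powr (- 1 / a n) - 1)
      - (- (1 / a0) * (G2 n + (1 - \<gamma>) / a0 * (W n / D)))) \<longlongrightarrow> 0) F"
    by simp
  moreover have "- (1 / a0) * (G2 n + (1 - \<gamma>) / a0 * (W n / D))
      = 6 / pi\<^sup>2 * ((\<gamma> - 1) * G1 n + - (Gamma''2 + 1) / a0 * G2 n + (1 - \<gamma>) * G3 n)" for n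
    using a0 by (simp add: W_def D_def Gamma''2_eq \<gamma>_def field_simps power2_eq_square)
  ultimately show "((\<lambda>n. v n * (t0 n powr (- 1 / a n) - 1)
            - 6 / pi\<^sup>2 * ((\<gamma> - 1) * G1 n + - (Gamma''2 + 1) / a0 * G2 n + (1 - \<gamma>) * G3 n)) \<longlongrightarrow> 0) F"
    by (simp only:)
qed

section \<open>Uniform expansion over samples\<close>

lemma all_equal_rescale: "s > 0 \<Longrightarrow> all_equal k (\<lambda>i. x i / s) \<longleftrightarrow> all_equal k x"
  by (simp add: all_equal_def)

lemma power_log_mean_0_rescale:
  assumes pos: "\<And>i. i \<in> {1..k} \<Longrightarrow> x i > 0" and s: "s > 0"
  shows "power_log_mean 0 k (\<lambda>i. x i / s) a = s powr a * power_log_mean 0 k x a"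
proof -
  have "(\<Sum>i=1..k. (x i / s) powr - a) = (\<Sum>i=1..k. s powr a * x i powr - a)"
    by (intro sum.cong refl) (use pos s in \<open>force simp: powr_divide powr_minus field_simps\<close>)
  then show ?thesis
    by (simp add: power_log_mean_def sample_mean_def flip: sum_distrib_left)
qed

text \<open>
  Dividing the sample by \<open>s\<close> shifts the mean of the logarithms and their weighted mean by the same
  amount \<open>ln s\<close>.
\<close>

lemma Psi_rescale:
  assumes k: "k \<ge> 1" and pos: "\<And>i. i \<in> {1..k} \<Longrightarrow> x i > 0" and s: "s > 0"
  shows "Psi k (\<lambda>i. x i / s) a = Psi k x a"
proof -
  have "(\<Sum>i=1..k. (x i / s) powr - a * ln (x i / s))
      = (\<Sum>i=1..k. s powr a * (x i powr - a * ln (x i)) - s powr a * ln s * x i powr - a)"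
    by (intro sum.cong refl)
       (use pos s in \<open>force simp: powr_divide powr_minus ln_div field_simps\<close>)
  then have "power_log_mean 1 k (\<lambda>i. x i / s) a = s powr a * (power_log_mean 1 k x a - ln s * power_log_mean 0 k x a)"
    by (simp add: power_log_mean_def sample_mean_def sum_subtractf diff_divide_distrib right_diff_distrib mult.assoc
        flip: sum_distrib_left)
  moreover have "(\<Sum>i=1..k. ln (x i / s)) = (\<Sum>i=1..k. ln (x i) - ln s)"
    by (intro sum.cong refl) (use pos s in \<open>force simp: ln_div\<close>)
  then have "sample_mean k (\<lambda>i. x i / s) ln = sample_mean k x ln - ln s"
    using k by (simp add: sample_mean_def sum_subtractf diff_divide_distrib)
  moreover have "power_log_mean 0 k (\<lambda>i. x i / s) a = s powr a * power_log_mean 0 k x a"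
    using pos s by (rule power_log_mean_0_rescale)
  ultimately show ?thesis
    using power_log_mean_0_pos[of k x a, OF k pos] s by (simp add: Psi_power_log_mean diff_divide_distrib)
qed

lemma mle_error_rescale:
  assumes k: "k \<ge> 1" and pos: "\<And>i. i \<in> {1..k} \<Longrightarrow> x i > 0" and s: "s > 0"
  shows "mle_error a0 v s k x = mle_error a0 v 1 k (\<lambda>i. x i / s)"
proof -
  have shape: "mle_shape k (\<lambda>i. x i / s) = mle_shape k x"
    using Psi_rescale[of k x s, OF k pos s] by (simp add: mle_shape_def all_equal_rescale[OF s])
  have "mle_scale k (\<lambda>i. x i / s) = mle_scale k x / s"
  proof (cases "all_equal k x")
    case False
    define a where "a = real_of_ereal (mle_shape k x)"
    have "a > 0"
      using theI'[OF ex1_Psi_zero[OF k pos False]] False by (simp add: a_def mle_shape_def)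
    have "mle_scale k (\<lambda>i. x i / s) = (s powr a * power_log_mean 0 k x a) powr (- 1 / a)"
      unfolding mle_scale_def all_equal_rescale[OF s] shape Let_def a_def[symmetric]
      using False power_log_mean_0_rescale[of k x s a, OF pos s] by (simp add: power_log_mean_def)
    also have "\<dots> = power_log_mean 0 k x a powr (- 1 / a) / s"
      using s \<open>a > 0\<close> power_log_mean_0_pos[of k x a, OF k pos]
      by (simp add: powr_mult powr_powr powr_minus_divide)
    also have "\<dots> = mle_scale k x / s"
      using False by (simp add: mle_scale_def a_def Let_def power_log_mean_def)
    finally show ?thesis .
  qed (simp add: mle_scale_def all_equal_rescale[OF s])
  then show ?thesis by (simp add: mle_error_def shape)
qed

lemma emp_vec_rescale: "emp_vec a0 v s k x = emp_vec a0 v 1 k (\<lambda>i. x i / s)"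
  by (simp add: emp_vec_def emp_process_def)

lemma vector_2_nth: "vector [x, y] $ (1::2) = x" "vector [x, y] $ (2::2) = y"
  by (simp_all add: vector_def)

lemma emp_vec_nth:
  assumes "a0 > 0"
  shows "emp_vec a0 v 1 k x $ 1 = v * (power_log_mean 1 k x a0 - (euler_mascheroni - 1) / a0)"
    and "emp_vec a0 v 1 k x $ 2 = v * (power_log_mean 0 k x a0 - 1)"
    and "emp_vec a0 v 1 k x $ 3 = v * (sample_mean k x ln - euler_mascheroni / a0)"
  by (simp_all add: emp_vec_def emp_process_def frechet_moments[OF assms] power_log_mean_def)

lemma M_mat_mult_nth:
  "(M_mat a *v y) $ 1
     = 6 / pi\<^sup>2 * (a\<^sup>2 * y $ 1 + a * (1 - euler_mascheroni) * y $ 2 - a\<^sup>2 * y $ 3)"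
  "(M_mat a *v y) $ 2
     = 6 / pi\<^sup>2 * ((euler_mascheroni - 1) * y $ 1 + - (Gamma''2 + 1) / a * y $ 2
         + (1 - euler_mascheroni) * y $ 3)"
  by (simp_all add: M_mat_def matrix_vector_mult_def sum_3 vector_2_nth distrib_left
      right_diff_distrib mult.assoc)

lemma mle_error_eq_ereal_vec:
  assumes k: "k \<ge> 1" and pos: "\<And>i. i \<in> {1..k} \<Longrightarrow> x i > 0" and ne: "\<not> all_equal k x"
  obtains a where "a > 0" "Psi k x a = 0"
    "mle_error a0 v 1 k x = vector [ereal (v * (a - a0)), ereal (v * (power_log_mean 0 k x a powr (- 1 / a) - 1))]"
proof
  let ?a = "THE a. a > 0 \<and> Psi k x a = 0"
  show "?a > 0" "Psi k x ?a = 0"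
    using theI'[OF ex1_Psi_zero[OF assms]] by simp_all
  show "mle_error a0 v 1 k x
      = vector [ereal (v * (?a - a0)), ereal (v * (power_log_mean 0 k x ?a powr (- 1 / ?a) - 1))]"
    using ne by (simp add: mle_error_def mle_shape_def mle_scale_def power_log_mean_def Let_def)
qed

text \<open>
  A statement about one sample at a time: the expansion holds up to \<open>\<epsilon>\<close> as soon as finitely many
  sample means lie in suitable ranges. If no \<open>\<eta>\<close> worked, the counterexamples for
  \<open>\<eta> = 1, 1/2, 1/3, \<dots>\<close> would form a sequence to which the asymptotic expansion applies. The bound
  \<open>B\<close> comes before \<open>\<eta>\<close> since the empirical process is only tight, not small.
\<close>

lemma mle_error_approx:
  fixes a0 \<delta> \<epsilon> B :: real
  assumes a0: "a0 > 0" and \<delta>: "\<delta> > 0" and \<epsilon>: "\<epsilon> > 0"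
  obtains \<eta> where "\<eta> > 0"
    "\<And>k x v i. \<lbrakk>k \<ge> 1; \<And>i. i \<in> {1..k} \<Longrightarrow> x i > 0; \<not> all_equal k x; v \<ge> 1 / \<eta>;
        norm (emp_vec a0 v 1 k x) \<le> B; \<bar>power_log_mean 2 k x a0 - Gamma''2 / a0\<^sup>2\<bar> \<le> \<eta>;
        power_log_mean 2 k x (a0 + \<delta>) + power_log_mean 2 k x (a0 - \<delta>) \<le> B\<rbrakk>
      \<Longrightarrow> \<bar>(mle_error a0 v 1 k x - ereal_vec (M_mat a0 *v emp_vec a0 v 1 k x)) $ i\<bar> \<le> ereal \<epsilon>"
proof -
  define bad where "bad = (\<lambda>\<eta> k x v. k \<ge> 1 \<and> (\<forall>i\<in>{1..k}. x i > 0) \<and> \<not> all_equal k x \<and> v \<ge> 1 / \<eta> \<and>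
      norm (emp_vec a0 v 1 k x) \<le> B \<and> \<bar>power_log_mean 2 k x a0 - Gamma''2 / a0\<^sup>2\<bar> \<le> \<eta> \<and>
      power_log_mean 2 k x (a0 + \<delta>) + power_log_mean 2 k x (a0 - \<delta>) \<le> B \<and>
      (\<exists>i. \<not> \<bar>(mle_error a0 v 1 k x - ereal_vec (M_mat a0 *v emp_vec a0 v 1 k x)) $ i\<bar> \<le> ereal \<epsilon>))"
  have "\<exists>\<eta>>0. \<forall>k x v. \<not> bad \<eta> k x v"
  proof (rule ccontr)
    assume "\<not> ?thesis"
    then have "\<forall>m. \<exists>k x v. bad (inverse (real (Suc m))) k x v"
      by (metis inverse_positive_iff_positive of_nat_0_less_iff zero_less_Suc)
    then obtain k x v where bad: "\<And>m. bad (inverse (real (Suc m))) (k m) (x m) (v m)"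
      by metis
    have k: "k m \<ge> 1" and pos: "\<And>i. i \<in> {1..k m} \<Longrightarrow> x m i > 0" and ne: "\<not> all_equal (k m) (x m)"
      and v: "v m \<ge> real (Suc m)" and G: "norm (emp_vec a0 (v m) 1 (k m) (x m)) \<le> B"
      and s2: "\<bar>power_log_mean 2 (k m) (x m) a0 - Gamma''2 / a0\<^sup>2\<bar> \<le> inverse (real (Suc m))"
      and T: "power_log_mean 2 (k m) (x m) (a0 + \<delta>) + power_log_mean 2 (k m) (x m) (a0 - \<delta>) \<le> B" for m
      using bad[of m] by (auto simp: bad_def inverse_eq_divide)
    have "\<exists>a. \<forall>m. a m > 0 \<and> Psi (k m) (x m) (a m) = 0 \<and> mle_error a0 (v m) 1 (k m) (x m)
        = vector [ereal (v m * (a m - a0)), ereal (v m * (power_log_mean 0 (k m) (x m) (a m) powr (- 1 / a m) - 1))]"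
      by (intro choice allI) (rule mle_error_eq_ereal_vec[OF k pos ne], blast+)
    then obtain a where a: "\<And>m. a m > 0" "\<And>m. Psi (k m) (x m) (a m) = 0"
      "\<And>m. mle_error a0 (v m) 1 (k m) (x m)
        = vector [ereal (v m * (a m - a0)), ereal (v m * (power_log_mean 0 (k m) (x m) (a m) powr (- 1 / a m) - 1))]"
      by metis
    let ?G = "\<lambda>m. emp_vec a0 (v m) 1 (k m) (x m)"
    let ?T = "\<lambda>m. power_log_mean 2 (k m) (x m) (a0 + \<delta>) + power_log_mean 2 (k m) (x m) (a0 - \<delta>)"
    have pos0: "power_log_mean 0 (k m) (x m) b > 0" for m b
      using power_log_mean_0_pos[of "k m" "x m" b, OF k pos] .
    have vpos: "v m > 0" for m using v[of m] by linarith
    have Gb: "(\<lambda>m. ?G m $ i) \<in> O(\<lambda>_. 1)" for i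
    proof (rule bigoI[of _ B], intro always_eventually allI)
      fix m
      show "norm (?G m $ i) \<le> B * norm (1::real)"
        using component_le_norm_cart[of "?G m" i] G[of m] by simp
    qed
    have Tb: "?T \<in> O(\<lambda>_. 1)"
    proof (rule bigoI[of _ B], intro always_eventually allI)
      fix m
      have "power_log_mean 2 (k m) (x m) b \<ge> 0" for b
        by (simp add: power_log_mean_def sample_mean_def sum_nonneg)
      then have "?T m \<ge> 0" by (simp add: add_nonneg_nonneg)
      with T[of m] show "norm (?T m) \<le> B * norm (1::real)" by simp
    qed
    have lim: "((\<lambda>m. power_log_mean 2 (k m) (x m) a0) \<longlongrightarrow> Gamma''2 / a0\<^sup>2) sequentially"
      by (rule LIM_zero_cancel, rule Lim_null_comparison[OF _ LIMSEQ_inverse_real_of_nat])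
         (use s2 in \<open>simp add: always_eventually\<close>)
    have v_top: "filterlim v at_top sequentially"
    proof (rule filterlim_at_top_mono[OF filterlim_real_sequentially], intro always_eventually allI)
      show "real m \<le> v m" for m using v[of m] by simp
    qed
    have zero: "1 / a m + power_log_mean 1 (k m) (x m) (a m) / power_log_mean 0 (k m) (x m) (a m) - sample_mean (k m) (x m) ln = 0" for m
      using a(2)[of m] by (simp add: Psi_power_log_mean)
    have close: "\<bar>1 / a m - 1 / a0\<bar> \<le>
        \<bar>1 / a0 + power_log_mean 1 (k m) (x m) a0 / power_log_mean 0 (k m) (x m) a0 - sample_mean (k m) (x m) ln\<bar>" for m
      using Psi_zero_close[of "k m" "x m" "a m" a0, OF k pos a(1) a0 a(2)] by (simp add: Psi_power_log_mean)
    have R0: "\<bar>power_log_mean 0 (k m) (x m) (a m) - power_log_mean 0 (k m) (x m) a0 + (a m - a0) * power_log_mean 1 (k m) (x m) a0\<bar>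
        \<le> (a m - a0)\<^sup>2 * ?T m" if "\<bar>a m - a0\<bar> \<le> \<delta> / 2" for m
      using power_log_mean_0_remainder[of "k m" "x m" "a m - a0" \<delta> a0, OF pos] that \<delta> by simp
    have R1: "\<bar>power_log_mean 1 (k m) (x m) (a m) - power_log_mean 1 (k m) (x m) a0 + (a m - a0) * power_log_mean 2 (k m) (x m) a0\<bar>
        \<le> 4 / \<delta> * ((a m - a0)\<^sup>2 * ?T m)" if "\<bar>a m - a0\<bar> \<le> \<delta> / 2" for m
      using power_log_mean_1_remainder[of "k m" "x m" "a m - a0" \<delta> a0, OF pos that \<delta>] by simp
    have \<delta>2: "\<delta> / 2 > 0" using \<delta> by simp
    note exp = mle_expansion[OF a0 \<delta>2 vpos v_top a(1) pos0 pos0 Gb[of 1, unfolded emp_vec_nth[OF a0]]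
        Gb[of 2, unfolded emp_vec_nth[OF a0]] Gb[of 3, unfolded emp_vec_nth[OF a0]] Tb lim zero close R0 R1]
    have "eventually (\<lambda>m. \<bar>v m * (a m - a0) - (M_mat a0 *v ?G m) $ 1\<bar> < \<epsilon>) sequentially"
         "eventually (\<lambda>m. \<bar>v m * (power_log_mean 0 (k m) (x m) (a m) powr (- 1 / a m) - 1)
             - (M_mat a0 *v ?G m) $ 2\<bar> < \<epsilon>) sequentially"
      using tendstoD[OF exp(1) \<epsilon>] tendstoD[OF exp(2) \<epsilon>]
      by (simp_all only: M_mat_mult_nth emp_vec_nth[OF a0] dist_real_def diff_zero)
    then have "eventually (\<lambda>m. False) sequentially"
    proof eventually_elim
      case (elim m)
      have "\<bar>(mle_error a0 (v m) 1 (k m) (x m) - ereal_vec (M_mat a0 *v ?G m)) $ i\<bar> \<le> ereal \<epsilon>" for i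
        using elim exhaust_2[of i] by (auto simp: a(3) ereal_vec_def vector_2_nth)
      then show False using bad[of m] unfolding bad_def by blast
    qed
    then show False by simp
  qed
  then show thesis
    using that unfolding bad_def by blast
qed

section \<open>Convergence in distribution and in probability\<close>

lemma conv_in_distr_map:
  fixes \<phi> :: "'c::topological_space \<Rightarrow> 'd::topological_space"
  assumes "conv_in_distr M Z \<nu>" and \<phi>: "continuous_on UNIV \<phi>" and \<nu>: "sets \<nu> = sets borel"
  shows "conv_in_distr M (\<lambda>n \<omega>. \<phi> (Z n \<omega>)) (distr \<nu> borel \<phi>)"
  unfolding conv_in_distr_def
proof (intro conjI allI impI)
  fix n
  show "(\<lambda>\<omega>. \<phi> (Z n \<omega>)) \<in> borel_measurable (M n)"
    using assms(1) by (intro borel_measurable_continuous_on[OF \<phi>]) (simp add: conv_in_distr_def)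
next
  fix f :: "'d \<Rightarrow> real" assume f: "continuous_on UNIV f \<and> bounded (range f)"
  have "continuous_on UNIV (\<lambda>z. f (\<phi> z))"
    by (rule continuous_on_compose2[OF conjunct1[OF f] \<phi> subset_UNIV])
  moreover have "bounded (range (\<lambda>z. f (\<phi> z)))"
    using f by (auto intro: bounded_subset)
  ultimately have "(\<lambda>n. \<integral>\<omega>. f (\<phi> (Z n \<omega>)) \<partial>M n) \<longlonglongrightarrow> (\<integral>z. f (\<phi> z) \<partial>\<nu>)"
    using assms(1) unfolding conv_in_distr_def by blast
  moreover have "(\<integral>z. f z \<partial>distr \<nu> borel \<phi>) = (\<integral>z. f (\<phi> z) \<partial>\<nu>)"
    using f \<phi> \<nu>
    by (intro integral_distr) (auto simp: measurable_cong_sets[OF \<nu> refl] intro!: borel_measurable_continuous_onI)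
  ultimately show "(\<lambda>n. \<integral>\<omega>. f (\<phi> (Z n \<omega>)) \<partial>M n) \<longlonglongrightarrow> (\<integral>z. f z \<partial>distr \<nu> borel \<phi>)"
    by simp
qed

text \<open>
  Markov's inequality for a bounded majorant \<open>f\<close> of an indicator. Applied with \<open>f\<close> a continuous
  function of a random element, it lets weak convergence control probabilities.
\<close>

lemma prob_le_expectation:
  assumes M: "prob_space M" and f: "f \<in> borel_measurable M"
    and "\<And>\<omega>. \<omega> \<in> space M \<Longrightarrow> 0 \<le> f \<omega> \<and> f \<omega> \<le> K"
    and "\<And>\<omega>. \<omega> \<in> space M \<Longrightarrow> P \<omega> \<Longrightarrow> 1 \<le> f \<omega>"
    and P: "{\<omega> \<in> space M. P \<omega>} \<in> sets M"
  shows "measure M {\<omega> \<in> space M. P \<omega>} \<le> (\<integral>\<omega>. f \<omega> \<partial>M)"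
proof -
  interpret prob_space M by fact
  have "measure M {\<omega> \<in> space M. P \<omega>} = (\<integral>\<omega>. indicator {\<omega> \<in> space M. P \<omega>} \<omega> \<partial>M)"
    using P by simp
  also have "\<dots> \<le> (\<integral>\<omega>. f \<omega> \<partial>M)"
  proof (rule integral_mono)
    show "integrable M f"
      using assms by (intro integrable_const_bound[of _ K]) (auto intro!: AE_I2)
    show "integrable M (indicator {\<omega> \<in> space M. P \<omega>} :: _ \<Rightarrow> real)"
      using P by (intro integrable_real_indicator) (auto simp: emeasure_eq_measure)
  qed (use assms in \<open>auto simp: indicator_def\<close>)
  finally show ?thesis .
qed

text \<open>
  The function \<open>f B\<close> is a continuous majorant of the indicator of \<open>{z. norm z > B + 1}\<close>, and its
  expectation under the limit law vanishes as \<open>B\<close> grows.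
\<close>

lemma conv_in_distr_tight:
  fixes Z :: "nat \<Rightarrow> 'a \<Rightarrow> 'c::real_normed_vector"
  assumes M: "\<And>n. prob_space (M n)" and \<nu>: "prob_space \<nu>" "sets \<nu> = sets borel"
    and conv: "conv_in_distr M Z \<nu>" and e: "e > 0"
  obtains B where "eventually (\<lambda>n. \<P>(\<omega> in M n. norm (Z n \<omega>) > B) < e) sequentially"
proof -
  interpret N: prob_space \<nu> by fact
  define f where "f = (\<lambda>B (z::'c). min 1 (max 0 (norm z - B)))"
  have fc: "continuous_on UNIV (f B)" for B
    unfolding f_def by (intro continuous_intros)
  have f01: "0 \<le> f B z" "f B z \<le> 1" for B z by (auto simp: f_def)
  have "(\<lambda>m. \<integral>z. f (real m) z \<partial>\<nu>) \<longlonglongrightarrow> (\<integral>z. 0 \<partial>\<nu>)"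
  proof (rule integral_dominated_convergence[where w = "\<lambda>_. 1"])
    show "AE z in \<nu>. (\<lambda>m. f (real m) z) \<longlonglongrightarrow> 0"
    proof (rule AE_I2, rule tendsto_eventually)
      fix z :: 'c
      have "eventually (\<lambda>m. real m \<ge> norm z) sequentially"
        using filterlim_real_sequentially by (simp add: filterlim_at_top)
      then show "eventually (\<lambda>m. f (real m) z = 0) sequentially"
        by eventually_elim (simp add: f_def)
    qed
    show "f (real m) \<in> borel_measurable \<nu>" for m
      using fc[of "real m"] by (simp add: measurable_cong_sets[OF \<nu>(2) refl] borel_measurable_continuous_onI)
  qed (use f01 in auto)
  then have "eventually (\<lambda>m. (\<integral>z. f (real m) z \<partial>\<nu>) < e) sequentially"
    using e by (intro order_tendstoD(2)) auto
  then obtain m where m: "(\<integral>z. f (real m) z \<partial>\<nu>) < e"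
    by (auto simp: eventually_sequentially)
  have "bounded (range (f (real m)))"
    using f01 by (auto simp: bounded_iff intro!: exI[of _ 1])
  then have "(\<lambda>n. \<integral>\<omega>. f (real m) (Z n \<omega>) \<partial>M n) \<longlonglongrightarrow> (\<integral>z. f (real m) z \<partial>\<nu>)"
    using conv fc unfolding conv_in_distr_def by blast
  then have "eventually (\<lambda>n. (\<integral>\<omega>. f (real m) (Z n \<omega>) \<partial>M n) < e) sequentially"
    using m by (rule order_tendstoD)
  then have "eventually (\<lambda>n. \<P>(\<omega> in M n. norm (Z n \<omega>) > real m + 1) < e) sequentially"
  proof eventually_elim
    case (elim n)
    have Z[measurable]: "Z n \<in> borel_measurable (M n)" using conv by (simp add: conv_in_distr_def)
    have "\<P>(\<omega> in M n. norm (Z n \<omega>) > real m + 1) \<le> (\<integral>\<omega>. f (real m) (Z n \<omega>) \<partial>M n)"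
    proof (rule prob_le_expectation[OF M _ conjI[OF f01]])
      show "(\<lambda>\<omega>. f (real m) (Z n \<omega>)) \<in> borel_measurable (M n)"
        by (rule borel_measurable_continuous_on[OF fc Z])
      show "{\<omega> \<in> space (M n). norm (Z n \<omega>) > real m + 1} \<in> sets (M n)" by measurable
    qed (auto simp: f_def)
    with elim show ?case by simp
  qed
  then show thesis by (rule that)
qed

lemma conv_in_distr_return_imp_prob:
  fixes Z :: "nat \<Rightarrow> 'a \<Rightarrow> real"
  assumes M: "\<And>n. prob_space (M n)" and conv: "conv_in_distr M Z (return borel c)" and e: "e > 0"
  shows "(\<lambda>n. \<P>(\<omega> in M n. \<bar>Z n \<omega> - c\<bar> > e)) \<longlonglongrightarrow> 0"
proof -
  define f where "f = (\<lambda>z. min 1 (\<bar>z - c\<bar> / e))"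
  have fc: "continuous_on UNIV f"
    unfolding f_def using e by (intro continuous_intros) auto
  have f01: "0 \<le> f z" "f z \<le> 1" for z using e by (auto simp: f_def)
  have "bounded (range f)"
    using f01 by (auto simp: bounded_iff intro!: exI[of _ 1])
  with conv fc have "(\<lambda>n. \<integral>\<omega>. f (Z n \<omega>) \<partial>M n) \<longlonglongrightarrow> (\<integral>z. f z \<partial>return borel c)"
    unfolding conv_in_distr_def by blast
  also have "(\<integral>z. f z \<partial>return borel c) = 0"
    using borel_measurable_continuous_onI[OF fc] by (subst integral_return) (auto simp: f_def)
  finally have lim: "(\<lambda>n. \<integral>\<omega>. f (Z n \<omega>) \<partial>M n) \<longlonglongrightarrow> 0" .
  show ?thesis
  proof (rule tendsto_sandwich[OF _ _ tendsto_const lim])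
    show "\<forall>\<^sub>F n in sequentially. \<P>(\<omega> in M n. \<bar>Z n \<omega> - c\<bar> > e) \<le> (\<integral>\<omega>. f (Z n \<omega>) \<partial>M n)"
    proof (intro always_eventually allI)
      fix n
      have Z[measurable]: "Z n \<in> borel_measurable (M n)" using conv by (simp add: conv_in_distr_def)
      show "\<P>(\<omega> in M n. \<bar>Z n \<omega> - c\<bar> > e) \<le> (\<integral>\<omega>. f (Z n \<omega>) \<partial>M n)"
      proof (rule prob_le_expectation[OF M _ conjI[OF f01]])
        show "(\<lambda>\<omega>. f (Z n \<omega>)) \<in> borel_measurable (M n)"
          by (rule borel_measurable_continuous_on[OF fc Z])
        show "{\<omega> \<in> space (M n). \<bar>Z n \<omega> - c\<bar> > e} \<in> sets (M n)" by measurable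
      qed (use e in \<open>auto simp: f_def\<close>)
    qed
  qed (auto intro: always_eventually)
qed

lemma continuous_ereal_vec: "continuous_on UNIV (ereal_vec :: real ^ 'd \<Rightarrow> ereal ^ 'd)"
  unfolding ereal_vec_def[abs_def] by (intro continuous_intros continuous_on_ereal)

text \<open>
  Slutsky's lemma. The comparison of \<open>f (W n)\<close> with \<open>f (ereal_vec (Z n))\<close> takes place in
  \<open>real ^ 'd\<close>, where \<open>f \<circ> ereal_vec\<close> is uniformly continuous on balls. By tightness, \<open>Z n\<close> stays in such a
  ball, and then \<open>W n\<close> is finite and stays in a slightly larger one.
\<close>

lemma conv_in_distr_small_o_p:
  fixes Z :: "nat \<Rightarrow> 'a \<Rightarrow> real ^ 'd" and W :: "nat \<Rightarrow> 'a \<Rightarrow> ereal ^ 'd"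
  assumes M: "\<And>n. prob_space (M n)" and \<nu>: "prob_space \<nu>" "sets \<nu> = sets borel"
    and conv: "conv_in_distr M Z \<nu>" and W: "\<And>n. W n \<in> borel_measurable (M n)"
    and op: "small_o_p M (\<lambda>n \<omega>. W n \<omega> - ereal_vec (Z n \<omega>))"
  shows "conv_in_distr M W (distr \<nu> borel ereal_vec)"
  unfolding conv_in_distr_def
proof (intro conjI allI impI W)
  fix f :: "ereal ^ 'd \<Rightarrow> real" assume f: "continuous_on UNIV f \<and> bounded (range f)"
  then obtain K where K: "K > 0" "\<And>z. \<bar>f z\<bar> \<le> K"
    by (auto simp: bounded_pos)
  let ?g = "\<lambda>z. f (ereal_vec z)"
  have g: "continuous_on UNIV ?g"
    by (rule continuous_on_compose2[OF conjunct1[OF f] continuous_ereal_vec subset_UNIV])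
  have Z: "Z n \<in> borel_measurable (M n)" for n using conv by (simp add: conv_in_distr_def)
  have "(\<lambda>n. (\<integral>\<omega>. f (W n \<omega>) \<partial>M n) - (\<integral>\<omega>. ?g (Z n \<omega>) \<partial>M n)) \<longlonglongrightarrow> 0"
  proof (rule tendstoI)
    fix e :: real assume "e > 0"
    \<comment> \<open>The error is at most \<open>e'\<close> on the good event and \<open>2 K\<close> on two bad events of
        probability below \<open>e'\<close>.\<close>
    define e' where "e' = e / (1 + 4 * K)"
    have e': "e' > 0"
      using \<open>e > 0\<close> K(1) by (simp add: e'_def)
    have "e' * (1 + 4 * K) = e" using K(1) by (simp add: e'_def)
    then have e'K: "e' + 2 * K * (e' + e') = e" by (simp add: algebra_simps)
    obtain B where B: "eventually (\<lambda>n. \<P>(\<omega> in M n. norm (Z n \<omega>) > B) < e') sequentially"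
      using conv_in_distr_tight[OF M \<nu> conv e'] .
    have "uniformly_continuous_on (cball 0 (B + 1)) ?g"
      by (intro compact_uniformly_continuous continuous_on_subset[OF g]) auto
    then obtain d where d: "d > 0" "\<And>z w. z \<in> cball 0 (B + 1) \<Longrightarrow> w \<in> cball 0 (B + 1) \<Longrightarrow>
        dist w z < d \<Longrightarrow> dist (?g w) (?g z) < e'"
      using e' unfolding uniformly_continuous_on_def by metis
    define \<delta> where "\<delta> = min d 1 / (2 * real CARD('d))"
    have \<delta>: "\<delta> > 0" "real CARD('d) * \<delta> < d" "real CARD('d) * \<delta> \<le> 1"
    proof -
      have "real CARD('d) * \<delta> = min d 1 / 2" by (simp add: \<delta>_def)
      then show "\<delta> > 0" "real CARD('d) * \<delta> < d" "real CARD('d) * \<delta> \<le> 1"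
        using d(1) by (auto simp: \<delta>_def)
    qed
    have near: "\<bar>f w - ?g z\<bar> < e'"
      if z: "norm z \<le> B" and wz: "\<And>i. \<bar>(w - ereal_vec z) $ i\<bar> \<le> ereal \<delta>" for w z
    proof -
      define u where "u = (\<chi> i. real_of_ereal (w $ i))"
      have wi: "w $ i = ereal (u $ i) \<and> \<bar>u $ i - z $ i\<bar> \<le> \<delta>" for i
        using wz[of i] by (cases "w $ i") (auto simp: u_def ereal_vec_def)
      then have w: "w = ereal_vec u" by (simp add: vec_eq_iff ereal_vec_def)
      have "norm (u - z) \<le> (\<Sum>i\<in>UNIV. \<bar>(u - z) $ i\<bar>)" by (rule norm_le_l1_cart)
      also have "\<dots> \<le> (\<Sum>i\<in>(UNIV::'d set). \<delta>)"
        using wi by (intro sum_mono) simp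
      finally have uz: "norm (u - z) \<le> real CARD('d) * \<delta>" by simp
      have "norm u \<le> B + 1"
        using norm_triangle_sub[of u z] uz z \<delta>(3) by linarith
      then have "dist (?g u) (?g z) < e'"
        using z uz \<delta>(2) by (intro d(2)) (auto simp: dist_norm)
      then show ?thesis by (simp add: w dist_real_def)
    qed
    have "(\<lambda>n. \<P>(\<omega> in M n. \<exists>i. \<bar>(W n \<omega> - ereal_vec (Z n \<omega>)) $ i\<bar> > ereal \<delta>)) \<longlonglongrightarrow> 0"
      using op \<delta>(1) unfolding small_o_p_def by blast
    then have "eventually (\<lambda>n. \<P>(\<omega> in M n. \<exists>i. \<bar>(W n \<omega> - ereal_vec (Z n \<omega>)) $ i\<bar> > ereal \<delta>) < e') sequentially"
      using e' by (rule order_tendstoD)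
    with B show "eventually (\<lambda>n. dist ((\<integral>\<omega>. f (W n \<omega>) \<partial>M n) - (\<integral>\<omega>. ?g (Z n \<omega>) \<partial>M n)) 0 < e) sequentially"
    proof eventually_elim
      case (elim n)
      interpret prob_space "M n" by (rule M)
      define A where "A = {\<omega> \<in> space (M n). norm (Z n \<omega>) > B}"
      define C where "C = {\<omega> \<in> space (M n). \<exists>i. \<bar>(W n \<omega> - ereal_vec (Z n \<omega>)) $ i\<bar> > ereal \<delta>}"
      have A: "A \<in> sets (M n)" unfolding A_def using Z[of n] by measurable
      have R: "(\<lambda>\<omega>. W n \<omega> - ereal_vec (Z n \<omega>)) \<in> borel_measurable (M n)"
        using op by (simp add: small_o_p_def)
      have Ri: "(\<lambda>\<omega>. (W n \<omega> - ereal_vec (Z n \<omega>)) $ i) \<in> borel_measurable (M n)" for i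
        by (rule borel_measurable_continuous_on[OF _ R]) (intro continuous_intros)
      have C: "C \<in> sets (M n)" unfolding C_def using Ri by measurable
      have fW: "(\<lambda>\<omega>. f (W n \<omega>)) \<in> borel_measurable (M n)"
        using f W by (intro borel_measurable_continuous_on[of f]) auto
      have gZ: "(\<lambda>\<omega>. ?g (Z n \<omega>)) \<in> borel_measurable (M n)"
        by (rule borel_measurable_continuous_on[OF g Z])
      have int: "integrable (M n) (\<lambda>\<omega>. f (W n \<omega>))" "integrable (M n) (\<lambda>\<omega>. ?g (Z n \<omega>))"
        using K(2) fW gZ by (auto intro!: integrable_const_bound[of _ K])
      have int2: "integrable (M n) (indicator A :: _ \<Rightarrow> real)" "integrable (M n) (indicator C :: _ \<Rightarrow> real)"
        using A C by (auto simp: emeasure_eq_measure)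
      have "norm (\<integral>\<omega>. f (W n \<omega>) - ?g (Z n \<omega>) \<partial>M n)
          \<le> (\<integral>\<omega>. e' + 2 * K * (indicator A \<omega> + indicator C \<omega>) \<partial>M n)"
      proof (rule order.trans[OF integral_norm_bound], rule integral_mono)
        fix \<omega> assume \<omega>: "\<omega> \<in> space (M n)"
        show "norm (f (W n \<omega>) - ?g (Z n \<omega>)) \<le> e' + 2 * K * (indicator A \<omega> + indicator C \<omega>)"
        proof (cases "\<omega> \<in> A \<or> \<omega> \<in> C")
          case True
          have "\<bar>f (W n \<omega>) - ?g (Z n \<omega>)\<bar> \<le> 2 * K"
            using K(2)[of "W n \<omega>"] K(2)[of "ereal_vec (Z n \<omega>)"] by linarith
          moreover have "1 \<le> indicator A \<omega> + (indicator C \<omega> :: real)" using True by (auto simp: indicator_def)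
          then have "2 * K * 1 \<le> 2 * K * (indicator A \<omega> + indicator C \<omega>)"
            using K(1) by (intro mult_left_mono) auto
          ultimately show ?thesis using e' by simp
        next
          case False
          then have "\<bar>f (W n \<omega>) - ?g (Z n \<omega>)\<bar> < e'"
            using \<omega> by (intro near) (auto simp: A_def C_def not_less)
          with False show ?thesis by simp
        qed
      qed (use int int2 in auto)
      also have "\<dots> = e' + 2 * K * (measure (M n) A + measure (M n) C)"
        using int2 A C by (simp add: prob_space)
      also have "\<dots> < e' + 2 * K * (e' + e')"
        using elim K(1) unfolding A_def C_def by (intro add_strict_left_mono mult_strict_left_mono add_strict_mono) auto
      also have "e' + 2 * K * (e' + e') = e" by (rule e'K)
      finally show ?case using int by (simp add: dist_real_def)
    qed
  qed
  moreover have "(\<lambda>n. \<integral>\<omega>. ?g (Z n \<omega>) \<partial>M n) \<longlonglongrightarrow> (\<integral>z. ?g z \<partial>\<nu>)"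
  proof -
    have "bounded (range ?g)" using f by (auto intro: bounded_subset)
    with conv g show ?thesis unfolding conv_in_distr_def by blast
  qed
  ultimately have "(\<lambda>n. ((\<integral>\<omega>. f (W n \<omega>) \<partial>M n) - (\<integral>\<omega>. ?g (Z n \<omega>) \<partial>M n)) + (\<integral>\<omega>. ?g (Z n \<omega>) \<partial>M n))
      \<longlonglongrightarrow> 0 + (\<integral>z. ?g z \<partial>\<nu>)"
    by (rule tendsto_add)
  moreover have "(\<integral>z. f z \<partial>distr \<nu> borel ereal_vec) = (\<integral>z. ?g z \<partial>\<nu>)"
    using f continuous_ereal_vec
    by (intro integral_distr) (auto simp: measurable_cong_sets[OF \<nu>(2) refl] intro!: borel_measurable_continuous_onI)
  ultimately show "(\<lambda>n. \<integral>\<omega>. f (W n \<omega>) \<partial>M n) \<longlonglongrightarrow> (\<integral>z. f z \<partial>distr \<nu> borel ereal_vec)"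
    by simp
qed


section \<open>Measurability of the estimators\<close>

text \<open>
  The product \<open>\<sigma>\<close>-algebra agrees with the Borel sets for a second countable factor, which for pairs
  is \<open>borel_measurable_Pair\<close>; this carries over along the homeomorphism with vectors.
\<close>

lemma borel_measurable_vec_2:
  fixes f :: "'a \<Rightarrow> 'c::second_countable_topology ^ 2"
  assumes "(\<lambda>\<omega>. f \<omega> $ 1) \<in> borel_measurable M" "(\<lambda>\<omega>. f \<omega> $ 2) \<in> borel_measurable M"
  shows "f \<in> borel_measurable M"
proof -
  have "continuous_on UNIV (\<lambda>p::'c \<times> 'c. (\<chi> i::2. if i = 1 then fst p else snd p))"
  proof (intro continuous_on_vec_lambda)
    show "continuous_on UNIV (\<lambda>p::'c \<times> 'c. if i = 1 then fst p else snd p)" for i :: 2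
      by (cases "i = 1") (auto intro: continuous_intros)
  qed
  from borel_measurable_continuous_on[OF this borel_measurable_Pair[OF assms]]
  show ?thesis
    by (rule measurable_cong[THEN iffD1, rotated]) (use exhaust_2 in \<open>auto simp: vec_eq_iff\<close>)
qed

text \<open>
  The root \<open>A\<close> of the decreasing function \<open>Psi\<close> exceeds \<open>c > 0\<close> exactly if \<open>Psi\<close> is positive at
  \<open>c\<close>, and this is an event for each \<open>c\<close>.
\<close>

lemma borel_measurable_mle:
  assumes X[measurable]: "\<And>i. i \<in> {1..k} \<Longrightarrow> X i \<in> borel_measurable M"
    and pos: "\<And>i \<omega>. i \<in> {1..k} \<Longrightarrow> \<omega> \<in> space M \<Longrightarrow> X i \<omega> > 0" and k: "k \<ge> 1"
  shows "{\<omega> \<in> space M. all_equal k (\<lambda>i. X i \<omega>)} \<in> sets M"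
    and "(\<lambda>\<omega>. mle_shape k (\<lambda>i. X i \<omega>)) \<in> borel_measurable M"
    and "(\<lambda>\<omega>. mle_scale k (\<lambda>i. X i \<omega>)) \<in> borel_measurable M"
proof -
  let ?E = "\<lambda>\<omega>. all_equal k (\<lambda>i. X i \<omega>)"
  have eq[measurable]: "Measurable.pred M ?E"
    unfolding all_equal_def by (intro pred_intros_finite) (use X in measurable)
  show "{\<omega> \<in> space M. ?E \<omega>} \<in> sets M" by measurable
  have sm: "(\<lambda>\<omega>. sample_mean k (\<lambda>i. X i \<omega>) (f \<omega>)) \<in> borel_measurable M"
    if "\<And>i. i \<in> {1..k} \<Longrightarrow> (\<lambda>\<omega>. f \<omega> (X i \<omega>)) \<in> borel_measurable M" for f
    unfolding sample_mean_def using that by measurable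
  have Psi[measurable]: "(\<lambda>\<omega>. Psi k (\<lambda>i. X i \<omega>) c) \<in> borel_measurable M" for c
    unfolding Psi_def by (intro borel_measurable_add borel_measurable_diff borel_measurable_divide
        borel_measurable_const sm) (use X in measurable)
  \<comment> \<open>The value \<open>1\<close> on constant samples is arbitrary; it only makes \<open>A\<close> positive everywhere.\<close>
  define A where "A = (\<lambda>\<omega>. if ?E \<omega> then 1 else THE a. a > 0 \<and> Psi k (\<lambda>i. X i \<omega>) a = 0)"
  have A: "A \<omega> > 0 \<and> Psi k (\<lambda>i. X i \<omega>) (A \<omega>) = 0" if "\<omega> \<in> space M" "\<not> ?E \<omega>" for \<omega>
    using theI'[OF ex1_Psi_zero[OF k pos that(2)]] that by (simp add: A_def)
  have A_gt: "c < A \<omega> \<longleftrightarrow> c \<le> 0 \<or> (if ?E \<omega> then c < 1 else Psi k (\<lambda>i. X i \<omega>) c > 0)"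
    if \<omega>: "\<omega> \<in> space M" for c \<omega>
  proof (cases "?E \<omega> \<or> c \<le> 0")
    case True
    then show ?thesis using A[OF \<omega>] by (auto simp: A_def)
  next
    case False
    then have "c > 0" "A \<omega> > 0" "Psi k (\<lambda>i. X i \<omega>) (A \<omega>) = 0" using A[OF \<omega>] by auto
    then have "c < A \<omega> \<longleftrightarrow> Psi k (\<lambda>i. X i \<omega>) c > 0"
      using Psi_strict_antimono[of k "\<lambda>i. X i \<omega>" c "A \<omega>"] Psi_strict_antimono[of k "\<lambda>i. X i \<omega>" "A \<omega>" c] k pos \<omega>
      by (cases c "A \<omega>" rule: linorder_cases) auto
    with False show ?thesis by simp
  qed
  have A_meas[measurable]: "A \<in> borel_measurable M"
    unfolding borel_measurable_iff_greater
  proof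
    fix c
    have "{\<omega> \<in> space M. c < A \<omega>}
        = {\<omega> \<in> space M. c \<le> 0 \<or> (if ?E \<omega> then c < 1 else Psi k (\<lambda>i. X i \<omega>) c > 0)}"
      using A_gt by blast
    also have "\<dots> \<in> sets M" by measurable
    finally show "{\<omega> \<in> space M. c < A \<omega>} \<in> sets M" .
  qed
  have "(\<lambda>\<omega>. mle_shape k (\<lambda>i. X i \<omega>)) = (\<lambda>\<omega>. if ?E \<omega> then \<infinity> else ereal (A \<omega>))"
    by (auto simp: mle_shape_def A_def)
  then show "(\<lambda>\<omega>. mle_shape k (\<lambda>i. X i \<omega>)) \<in> borel_measurable M" by simp
  have "(\<lambda>\<omega>. mle_scale k (\<lambda>i. X i \<omega>))
      = (\<lambda>\<omega>. if ?E \<omega> then X 1 \<omega> else sample_mean k (\<lambda>i. X i \<omega>) (\<lambda>y. y powr - A \<omega>) powr (- 1 / A \<omega>))"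
    by (auto simp: mle_scale_def mle_shape_def A_def Let_def)
  moreover have [measurable]: "(\<lambda>\<omega>. sample_mean k (\<lambda>i. X i \<omega>) (\<lambda>y. y powr - A \<omega>)) \<in> borel_measurable M"
    by (intro sm) (use X in measurable)
  moreover have [measurable]: "X 1 \<in> borel_measurable M" using k by (intro X) simp
  have "(\<lambda>\<omega>. if ?E \<omega> then X 1 \<omega> else sample_mean k (\<lambda>i. X i \<omega>) (\<lambda>y. y powr - A \<omega>) powr (- 1 / A \<omega>))
      \<in> borel_measurable M" by measurable
  ultimately show "(\<lambda>\<omega>. mle_scale k (\<lambda>i. X i \<omega>)) \<in> borel_measurable M"
    by (simp only:)
qed

section \<open>The estimation error\<close>

theorem theorem2p5:
  fixes M :: "nat \<Rightarrow> 'a measure" and N :: "'b measure"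
    and k :: "nat \<Rightarrow> nat" and X :: "nat \<Rightarrow> nat \<Rightarrow> 'a \<Rightarrow> real"
    and \<alpha>\<^sub>0 :: real and \<sigma> v :: "nat \<Rightarrow> real" and Y :: "'b \<Rightarrow> real ^ 3"
  assumes "\<And>n. prob_space (M n)"
    and "\<And>n i. i \<in> {1..k n} \<Longrightarrow> X n i \<in> borel_measurable (M n)"
    and "\<And>n i \<omega>. i \<in> {1..k n} \<Longrightarrow> \<omega> \<in> space (M n) \<Longrightarrow> X n i \<omega> > 0"
    and "\<And>n. k n \<ge> 2"
    and "filterlim k at_top sequentially"
    and "(\<lambda>n. \<P>(\<omega> in M n. all_equal (k n) (\<lambda>i. X n i \<omega>))) \<longlonglongrightarrow> 0"
    and "\<alpha>\<^sub>0 > 0"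
    and "\<And>n. \<sigma> n > 0"
    and "\<exists>\<alpha>m \<alpha>p. 0 < \<alpha>m \<and> \<alpha>m < \<alpha>\<^sub>0 \<and> \<alpha>\<^sub>0 < \<alpha>p \<and>
           (\<forall>f\<in>F2 \<alpha>m \<alpha>p.
              conv_in_distr M (\<lambda>n \<omega>. sample_mean (k n) (\<lambda>i. X n i \<omega> / \<sigma> n) f)
                (return borel (frechet_expectation \<alpha>\<^sub>0 f)))"
    and "\<And>n. v n > 0"
    and "filterlim v at_top sequentially"
    and "prob_space N"
    and "Y \<in> borel_measurable N"
    and "conv_in_distr M (\<lambda>n \<omega>. emp_vec \<alpha>\<^sub>0 (v n) (\<sigma> n) (k n) (\<lambda>i. X n i \<omega>)) (distr N borel Y)"
  shows "small_o_p M
           (\<lambda>n \<omega>. mle_error \<alpha>\<^sub>0 (v n) (\<sigma> n) (k n) (\<lambda>i. X n i \<omega>)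
              - ereal_vec (M_mat \<alpha>\<^sub>0 *v emp_vec \<alpha>\<^sub>0 (v n) (\<sigma> n) (k n) (\<lambda>i. X n i \<omega>)))
       \<and> conv_in_distr M
           (\<lambda>n \<omega>. mle_error \<alpha>\<^sub>0 (v n) (\<sigma> n) (k n) (\<lambda>i. X n i \<omega>))
           (distr N borel (\<lambda>\<omega>. ereal_vec (M_mat \<alpha>\<^sub>0 *v Y \<omega>)))"
proof -
  note M = assms(1) and X = assms(2) and pos = assms(3) and a0 = assms(7) and \<sigma> = assms(8) and v = assms(10)
  define G where "G = (\<lambda>n \<omega>. emp_vec \<alpha>\<^sub>0 (v n) (\<sigma> n) (k n) (\<lambda>i. X n i \<omega>))"
  define W where "W = (\<lambda>n \<omega>. mle_error \<alpha>\<^sub>0 (v n) (\<sigma> n) (k n) (\<lambda>i. X n i \<omega>))"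
  define R where "R = (\<lambda>n \<omega>. W n \<omega> - ereal_vec (M_mat \<alpha>\<^sub>0 *v G n \<omega>))"
  define S where "S = (\<lambda>a n \<omega>. power_log_mean 2 (k n) (\<lambda>i. X n i \<omega> / \<sigma> n) a)"
  have k: "k n \<ge> 1" for n using assms(4)[of n] by simp
  have G: "conv_in_distr M G (distr N borel Y)" using assms(14) by (simp add: G_def)
  have Gm[measurable]: "G n \<in> borel_measurable (M n)" for n using G by (simp add: conv_in_distr_def)
  have NY: "prob_space (distr N borel Y)"
    using assms(12,13) by (rule prob_space.prob_space_distr)

  have lin: "continuous_on UNIV (\<lambda>y. M_mat \<alpha>\<^sub>0 *v y)"
    by (intro linear_continuous_on matrix_vector_mul_bounded_linear)
  have MG: "conv_in_distr M (\<lambda>n \<omega>. M_mat \<alpha>\<^sub>0 *v G n \<omega>) (distr (distr N borel Y) borel (\<lambda>y. M_mat \<alpha>\<^sub>0 *v y))"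
    by (rule conv_in_distr_map[OF G lin]) simp
  then have MGm[measurable]: "(\<lambda>\<omega>. M_mat \<alpha>\<^sub>0 *v G n \<omega>) \<in> borel_measurable (M n)" for n
    by (simp add: conv_in_distr_def)

  note mle_meas = borel_measurable_mle[OF X pos k]
  have W1[measurable]: "(\<lambda>\<omega>. W n \<omega> $ 1) \<in> borel_measurable (M n)" for n
    unfolding W_def mle_error_def vector_2_nth
    by (intro borel_measurable_ereal_times borel_measurable_ereal_diff borel_measurable_const mle_meas)
  have W2[measurable]: "(\<lambda>\<omega>. W n \<omega> $ 2) \<in> borel_measurable (M n)" for n
    unfolding W_def mle_error_def vector_2_nth
    by (intro borel_measurable_ereal borel_measurable_times borel_measurable_diff borel_measurable_divide
        borel_measurable_const mle_meas)
  have Wm: "W n \<in> borel_measurable (M n)" for n by (intro borel_measurable_vec_2 W1 W2)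
  have c: "(\<lambda>\<omega>. ereal ((M_mat \<alpha>\<^sub>0 *v G n \<omega>) $ i)) \<in> borel_measurable (M n)" for n i
    by (intro borel_measurable_ereal borel_measurable_continuous_on[OF _ MGm]) (intro continuous_intros)
  have R1: "(\<lambda>\<omega>. R n \<omega> $ 1) \<in> borel_measurable (M n)" and R2: "(\<lambda>\<omega>. R n \<omega> $ 2) \<in> borel_measurable (M n)" for n
    unfolding R_def vector_minus_component ereal_vec_def vec_lambda_beta
    by (intro borel_measurable_ereal_diff W1 W2 c)+
  have Rm: "R n \<in> borel_measurable (M n)" for n by (intro borel_measurable_vec_2 R1 R2)

  obtain \<alpha>m \<alpha>p where ab: "\<alpha>m < \<alpha>\<^sub>0" "\<alpha>\<^sub>0 < \<alpha>p" and F2: "\<And>f. f \<in> F2 \<alpha>m \<alpha>p \<Longrightarrow>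
      conv_in_distr M (\<lambda>n \<omega>. sample_mean (k n) (\<lambda>i. X n i \<omega> / \<sigma> n) f) (return borel (frechet_expectation \<alpha>\<^sub>0 f))"
    using assms(9) by blast
  \<comment> \<open>Condition (i) is used for \<open>y powr - a * (ln y)\<^sup>2\<close> at the three exponents \<open>\<alpha>\<^sub>0\<close> and \<open>\<alpha>\<^sub>0 \<plusminus> \<delta>\<close>. The
      outer two give a bound in probability on the second-order remainders.\<close>
  define \<delta> where "\<delta> = min (\<alpha>\<^sub>0 - \<alpha>m) (\<alpha>p - \<alpha>\<^sub>0) / 2"
  have \<delta>: "\<delta> > 0" "\<alpha>m < \<alpha>\<^sub>0 - \<delta>" "\<alpha>\<^sub>0 + \<delta> < \<alpha>p" using ab by (auto simp: \<delta>_def min_def field_simps)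
  define m where "m = (\<lambda>a. frechet_expectation \<alpha>\<^sub>0 (\<lambda>y. y powr - a * (ln y)\<^sup>2))"
  have S: "conv_in_distr M (S a) (return borel (m a))" if "\<alpha>m < a" "a < \<alpha>p" for a
    unfolding S_def power_log_mean_def m_def by (rule F2) (use that in \<open>auto simp: F2_def\<close>)
  have m0: "m \<alpha>\<^sub>0 = Gamma''2 / \<alpha>\<^sub>0\<^sup>2" unfolding m_def by (rule frechet_moments(3)[OF a0])

  have R_small: "(\<lambda>n. \<P>(\<omega> in M n. \<exists>i. \<bar>R n \<omega> $ i\<bar> > ereal \<epsilon>)) \<longlonglongrightarrow> 0" if \<epsilon>: "\<epsilon> > 0" for \<epsilon>
  proof (rule tendstoI)
    fix e :: real assume "e > 0"
    then have e: "e / 2 > 0" by simp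
    obtain B1 where B1: "eventually (\<lambda>n. \<P>(\<omega> in M n. norm (G n \<omega>) > B1) < e / 2) sequentially"
      using conv_in_distr_tight[OF M NY _ G e] by auto
    define B where "B = max B1 (m (\<alpha>\<^sub>0 + \<delta>) + m (\<alpha>\<^sub>0 - \<delta>) + 2)"
    obtain \<eta> where \<eta>: "\<eta> > 0"
      "\<And>k x v i. \<lbrakk>k \<ge> 1; \<And>i. i \<in> {1..k} \<Longrightarrow> x i > 0; \<not> all_equal k x; v \<ge> 1 / \<eta>;
        norm (emp_vec \<alpha>\<^sub>0 v 1 k x) \<le> B; \<bar>power_log_mean 2 k x \<alpha>\<^sub>0 - Gamma''2 / \<alpha>\<^sub>0\<^sup>2\<bar> \<le> \<eta>;
        power_log_mean 2 k x (\<alpha>\<^sub>0 + \<delta>) + power_log_mean 2 k x (\<alpha>\<^sub>0 - \<delta>) \<le> B\<rbrakk>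
      \<Longrightarrow> \<bar>(mle_error \<alpha>\<^sub>0 v 1 k x - ereal_vec (M_mat \<alpha>\<^sub>0 *v emp_vec \<alpha>\<^sub>0 v 1 k x)) $ i\<bar> \<le> ereal \<epsilon>"
      using mle_error_approx[OF a0 \<delta>(1) \<epsilon>] by metis
    \<comment> \<open>The exceptional events. Only \<open>E1\<close> does not become negligible, but its probability is
        eventually below \<open>e / 2\<close>; the slack of \<open>2\<close> in \<open>B\<close> absorbs the deviations in the two
        events with threshold \<open>1\<close>.\<close>
    define E1 where "E1 = (\<lambda>n. {\<omega> \<in> space (M n). norm (G n \<omega>) > B1})"
    define E2 where "E2 = (\<lambda>n. {\<omega> \<in> space (M n). all_equal (k n) (\<lambda>i. X n i \<omega>)})"
    define E3 where "E3 = (\<lambda>a d n. {\<omega> \<in> space (M n). \<bar>S a n \<omega> - m a\<bar> > d})"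
    have E1: "E1 n \<in> sets (M n)" for n unfolding E1_def by measurable
    have E2: "E2 n \<in> sets (M n)" for n unfolding E2_def by (rule mle_meas)
    have E3: "E3 a d n \<in> sets (M n)" if "\<alpha>m < a" "a < \<alpha>p" for a d n
    proof -
      have [measurable]: "S a n \<in> borel_measurable (M n)" using S[OF that] by (simp add: conv_in_distr_def)
      show ?thesis unfolding E3_def by measurable
    qed
    let ?s = "\<lambda>n. measure (M n) (E2 n) + measure (M n) (E3 \<alpha>\<^sub>0 \<eta> n)
        + measure (M n) (E3 (\<alpha>\<^sub>0 + \<delta>) 1 n) + measure (M n) (E3 (\<alpha>\<^sub>0 - \<delta>) 1 n)"
    have "?s \<longlonglongrightarrow> 0 + 0 + 0 + 0"
      unfolding E2_def E3_def using \<eta>(1) \<delta> ab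
      by (intro tendsto_add assms(6) conv_in_distr_return_imp_prob[OF M S]) auto
    then have "eventually (\<lambda>n. ?s n < e / 2) sequentially"
      using e by (intro order_tendstoD(2)) auto
    moreover have "eventually (\<lambda>n. v n \<ge> 1 / \<eta>) sequentially"
      using assms(11) by (simp add: filterlim_at_top)
    ultimately show "eventually (\<lambda>n. dist (\<P>(\<omega> in M n. \<exists>i. \<bar>R n \<omega> $ i\<bar> > ereal \<epsilon>)) 0 < e) sequentially"
      using B1
    proof eventually_elim
      case (elim n)
      interpret prob_space "M n" by (rule M)
      let ?U = "E1 n \<union> (E2 n \<union> (E3 \<alpha>\<^sub>0 \<eta> n \<union> (E3 (\<alpha>\<^sub>0 + \<delta>) 1 n \<union> E3 (\<alpha>\<^sub>0 - \<delta>) 1 n)))"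
      have "{\<omega> \<in> space (M n). \<exists>i. \<bar>R n \<omega> $ i\<bar> > ereal \<epsilon>} \<subseteq> ?U"
      proof
        fix \<omega> assume "\<omega> \<in> {\<omega> \<in> space (M n). \<exists>i. \<bar>R n \<omega> $ i\<bar> > ereal \<epsilon>}"
        then obtain i where \<omega>: "\<omega> \<in> space (M n)" and i: "\<bar>R n \<omega> $ i\<bar> > ereal \<epsilon>" by auto
        let ?x = "\<lambda>i. X n i \<omega> / \<sigma> n"
        show "\<omega> \<in> ?U"
        proof (rule ccontr)
          assume out: "\<omega> \<notin> ?U"
          have "\<bar>(mle_error \<alpha>\<^sub>0 (v n) 1 (k n) ?x - ereal_vec (M_mat \<alpha>\<^sub>0 *v emp_vec \<alpha>\<^sub>0 (v n) 1 (k n) ?x)) $ i\<bar>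
              \<le> ereal \<epsilon>"
          proof (rule \<eta>(2))
            show "\<not> all_equal (k n) ?x"
              using out \<omega> by (simp add: E2_def all_equal_rescale[OF \<sigma>])
            show "norm (emp_vec \<alpha>\<^sub>0 (v n) 1 (k n) ?x) \<le> B"
              using out \<omega> by (simp add: E1_def G_def B_def le_max_iff_disj not_less flip: emp_vec_rescale)
            show "\<bar>power_log_mean 2 (k n) ?x \<alpha>\<^sub>0 - Gamma''2 / \<alpha>\<^sub>0\<^sup>2\<bar> \<le> \<eta>"
              using out \<omega> by (simp add: E3_def S_def m0)
            show "power_log_mean 2 (k n) ?x (\<alpha>\<^sub>0 + \<delta>) + power_log_mean 2 (k n) ?x (\<alpha>\<^sub>0 - \<delta>) \<le> B"
              using out \<omega> unfolding E3_def S_def B_def by (simp add: le_max_iff_disj) linarith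
          qed (use k elim pos \<sigma> \<omega> in auto)
          moreover have "W n \<omega> = mle_error \<alpha>\<^sub>0 (v n) 1 (k n) ?x"
            unfolding W_def using k pos \<omega> \<sigma> by (intro mle_error_rescale) auto
          moreover have "G n \<omega> = emp_vec \<alpha>\<^sub>0 (v n) 1 (k n) ?x"
            unfolding G_def by (rule emp_vec_rescale)
          ultimately show False using i by (simp add: R_def)
        qed
      qed
      then have "\<P>(\<omega> in M n. \<exists>i. \<bar>R n \<omega> $ i\<bar> > ereal \<epsilon>) \<le> measure (M n) ?U"
        using E1 E2 E3 \<delta> ab by (intro finite_measure_mono sets.Un) auto
      also have "\<dots> \<le> measure (M n) (E1 n) + (measure (M n) (E2 n) + (measure (M n) (E3 \<alpha>\<^sub>0 \<eta> n)
          + (measure (M n) (E3 (\<alpha>\<^sub>0 + \<delta>) 1 n) + measure (M n) (E3 (\<alpha>\<^sub>0 - \<delta>) 1 n))))"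
      proof -
        have m: "E1 n \<in> sets (M n)" "E2 n \<in> sets (M n)" "E3 \<alpha>\<^sub>0 \<eta> n \<in> sets (M n)"
          "E3 (\<alpha>\<^sub>0 + \<delta>) 1 n \<in> sets (M n)" "E3 (\<alpha>\<^sub>0 - \<delta>) 1 n \<in> sets (M n)"
          using E1 E2 E3 \<delta> ab by auto
        note m' = sets.Un[OF m(4,5)]
        note m'' = sets.Un[OF m(3) m']
        from measure_Un_le[OF m(1) sets.Un[OF m(2) m'']] measure_Un_le[OF m(2) m'']
          measure_Un_le[OF m(3) m'] measure_Un_le[OF m(4,5)]
        show ?thesis by linarith
      qed
      also have "\<dots> < e" using elim unfolding E1_def by linarith
      finally show ?case by simp
    qed
  qed
  have op: "small_o_p M R" unfolding small_o_p_def using Rm R_small by blast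
  have "conv_in_distr M W (distr (distr (distr N borel Y) borel (\<lambda>y. M_mat \<alpha>\<^sub>0 *v y)) borel ereal_vec)"
  proof (rule conv_in_distr_small_o_p[OF M _ _ MG Wm])
    show "prob_space (distr (distr N borel Y) borel (\<lambda>y. M_mat \<alpha>\<^sub>0 *v y))"
      using NY by (rule prob_space.prob_space_distr) (simp add: borel_measurable_continuous_onI lin)
  qed (use op in \<open>simp_all add: R_def\<close>)
  also have "distr (distr (distr N borel Y) borel (\<lambda>y. M_mat \<alpha>\<^sub>0 *v y)) borel ereal_vec
      = distr N borel (\<lambda>\<omega>. ereal_vec (M_mat \<alpha>\<^sub>0 *v Y \<omega>))"
  proof -
    note lin_m = borel_measurable_continuous_onI[OF lin]
    show ?thesis
      unfolding distr_distr[OF lin_m assms(13)]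
        distr_distr[OF borel_measurable_continuous_onI[OF continuous_ereal_vec] measurable_comp[OF assms(13) lin_m]]
      by (simp only: o_def)
  qed
  finally show ?thesis using op unfolding R_def W_def G_def by (rule conjI[rotated])
qed
end
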